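(* There exist universal constants $C_0>0$ and $c>0$ such that the following holds. Let $n/\mu\ge\max\{4,r\}$ and $\mu\ge12\log(12n)$. For $\lambda^\star>0$, let $\Omega(\lambda^\star,\mu,r)=\{(\boldsymbol{\Lambda}^\star,\boldsymbol{U}^\star):\boldsymbol{\Lambda}^\star=\lambda^\star\boldsymbol{I}_r,\ \boldsymbol{U}^\star\in\mathbb{K}_{r,\mu}\}$ and, for each such pair, let $\mathbb{E}_{\boldsymbol{\Lambda}^\star,\boldsymbol{U}^\star}$ denote expectation when observing $\boldsymbol{Y}=\boldsymbol{U}^\star\boldsymbol{\Lambda}^\star{\boldsymbol{U}^\star}^\top+\boldsymbol{W}$ with $\boldsymbol{W}$ symmetric having independent $N(0,\sigma^2)$ entries on and above the diagonal. Then for any $0<\lambda^\star\le(6\sqrt{C_0})^{-1}\sigma\sqrt n$ and all sufficiently large $n$, $$\inf_{\widehat{\boldsymbol{U}}}\ \sup_{(\boldsymbol{\Lambda}^\star,\boldsymbol{U}^\star)\in\Omega(\lambda^\star,\mu,r)}\mathbb{E}_{\boldsymbol{\Lambda}^\star,\boldsymbol{U}^\star}\,d_{2,\infty}(\widehat{\boldsymbol{U}},\boldsymbol{U}^\star)\ \ge\ c\left(\frac{\sigma\sqrt r}{\lambda^\star}\wedge\sqrt{\frac{\mu r}{n\log(n/\mu)}}\right),$$ where the infimum is over all estimators $\widehat{\boldsymbol{U}}\in\mathbb{R}^{n\times r}$ (measurable functions of $\boldsymbol{Y}$).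
   Context: $\mathbb{K}_{r,\mu}=\{\boldsymbol{U}\in\mathbb{R}^{n\times r}:\boldsymbol{U}^\top\boldsymbol{U}=\boldsymbol{I}_r,\ \|\boldsymbol{U}\|_{2,\infty}\le\sqrt{r\mu/n}\}$, where $\|\cdot\|_{2,\infty}$ is the maximum row Euclidean norm. $d_{2,\infty}(\boldsymbol{U}_1,\boldsymbol{U}_2)=\min_{\boldsymbol{\Gamma}\in\mathbb{O}_r}\|\boldsymbol{U}_2-\boldsymbol{U}_1\boldsymbol{\Gamma}\|_{2,\infty}$. $a\wedge b=\min\{a,b\}$. *)

theory Defs
  imports "HOL-Probability.Probability"
begin

text \<open>Matrices are functions on index pairs; an m x k matrix is only read
  at indices (i,j) with i < m and j < k.\<close>
type_synonym mat = "nat \<times> nat \<Rightarrow> real"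

definition norm_2inf :: "nat \<Rightarrow> nat \<Rightarrow> mat \<Rightarrow> real" where
  "norm_2inf n r A = Max ((\<lambda>i. sqrt (\<Sum>j<r. (A (i, j))\<^sup>2)) ` {..<n})"

definition orthonormal_cols :: "nat \<Rightarrow> nat \<Rightarrow> mat \<Rightarrow> bool" where
  "orthonormal_cols n r A \<longleftrightarrow>
     (\<forall>a<r. \<forall>b<r. (\<Sum>k<n. A (k, a) * A (k, b)) = (if a = b then 1 else 0))"

definition orth_group :: "nat \<Rightarrow> mat set" where
  "orth_group r = {G. orthonormal_cols r r G}"

definition mat_mult :: "nat \<Rightarrow> mat \<Rightarrow> mat \<Rightarrow> mat" where
  "mat_mult r A B = (\<lambda>(i, j). \<Sum>k<r. A (i, k) * B (k, j))"

definition K_set :: "nat \<Rightarrow> nat \<Rightarrow> real \<Rightarrow> mat set" where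
  "K_set n r \<mu> = {U. orthonormal_cols n r U \<and> norm_2inf n r U \<le> sqrt (r * \<mu> / n)}"

text \<open>d_{2,inf}(U1,U2) = min over orthogonal Gamma of ||U2 - U1 Gamma||_{2,inf}
  (the minimum is attained by compactness, so it equals the infimum).\<close>
definition d_2inf :: "nat \<Rightarrow> nat \<Rightarrow> mat \<Rightarrow> mat \<Rightarrow> real" where
  "d_2inf n r U1 U2 =
     Inf ((\<lambda>G. norm_2inf n r (\<lambda>ij. U2 ij - mat_mult r U1 G ij)) ` orth_group r)"

text \<open>Signal U Lambda U^T with Lambda = lam * I_r.\<close>
definition signal :: "nat \<Rightarrow> real \<Rightarrow> mat \<Rightarrow> mat" where
  "signal r lam U = (\<lambda>(i, j). lam * (\<Sum>k<r. U (i, k) * U (j, k)))"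

definition noise_space :: "nat \<Rightarrow> real \<Rightarrow> (nat \<times> nat \<Rightarrow> real) measure" where
  "noise_space n \<sigma> =
     PiM {(i, j). i \<le> j \<and> j < n} (\<lambda>_. density lborel (normal_density 0 \<sigma>))"

definition observe :: "nat \<Rightarrow> mat \<Rightarrow> (nat \<times> nat \<Rightarrow> real) \<Rightarrow> mat" where
  "observe n M w =
     restrict (\<lambda>(i, j). M (i, j) + w (min i j, max i j)) ({..<n} \<times> {..<n})"

definition obs_space :: "nat \<Rightarrow> mat measure" where
  "obs_space n = PiM ({..<n} \<times> {..<n}) (\<lambda>_. borel)"

definition est_space :: "nat \<Rightarrow> nat \<Rightarrow> mat measure" where
  "est_space n r = PiM ({..<n} \<times> {..<r}) (\<lambda>_. borel)"

definition risk :: "nat \<Rightarrow> nat \<Rightarrow> real \<Rightarrow> real \<Rightarrow> (mat \<Rightarrow> mat) \<Rightarrow> mat \<Rightarrow> ennreal" where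
  "risk n r \<sigma> lam Uhat U =
     (\<integral>\<^sup>+ w. ennreal (d_2inf n r (Uhat (observe n (signal r lam U) w)) U) \<partial>noise_space n \<sigma>)"

end

theory Submission
  imports Defs
begin

text \<open>Stack an identity block and \<open>b\<close> orthogonal \<open>r \<times> r\<close> matrices and divide by \<open>sqrt (b + 1)\<close>. The
  result has orthonormal columns, and all its nonzero rows have norm \<open>1 / sqrt (b + 1)\<close>, so it is
  incoherent as soon as \<open>(b + 1) r \<ge> n / \<mu>\<close>. The orthogonal group contains \<open>exp (c r\<^sup>2)\<close> matrices at
  mutual Frobenius distance at least \<open>sqrt r / 7\<close>, which yields \<open>exp (c b r\<^sup>2)\<close> stacked matrices. They
  are at mutual distance of order \<open>1 / sqrt b\<close> even up to rotation: a rotation that nearly aligns two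
  of them must be close to the identity because of the block they share, and then it cannot make up
  for a difference in another block. The likelihood ratio of each hypothesis against pure noise has
  second moment at most \<open>exp (\<lambda>\<^sup>2 r / \<sigma>\<^sup>2)\<close>, so by Cauchy-Schwarz the hypotheses cannot be told apart
  once \<open>b r\<close> is a large multiple of \<open>\<lambda>\<^sup>2 / \<sigma>\<^sup>2 + n / \<mu>\<close>; the conditions on \<open>\<lambda>\<close> and \<open>\<mu>\<close> leave room for
  these rows. The resulting bound is of order \<open>1 / sqrt b\<close>, which is
  \<open>min (\<sigma> sqrt r / \<lambda>) (sqrt (\<mu> r / n))\<close> up to a constant.\<close>

section \<open>Matrices with orthonormal columns\<close>

lemma L2_set_power2: "(L2_set f A)\<^sup>2 = (\<Sum>i\<in>A. (f i)\<^sup>2)"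
  by (simp add: L2_set_def sum_nonneg)

lemma L2_set_diff_le: "L2_set (\<lambda>i. f i - g i) A \<le> L2_set f A + L2_set g A"
  using L2_set_triangle_ineq[of f "\<lambda>i. - g i" A] by (simp add: L2_set_def)

lemma orthonormal_colsD:
  "orthonormal_cols n r A \<Longrightarrow> a < r \<Longrightarrow> b < r \<Longrightarrow>
    (\<Sum>k<n. A (k, a) * A (k, b)) = (if a = b then 1 else 0)"
  by (simp add: orthonormal_cols_def)

lemma inner_orthonormal_cols:
  assumes "orthonormal_cols n r A"
  shows "(\<Sum>i<n. (\<Sum>k<r. A (i, k) * x k) * (\<Sum>k<r. A (i, k) * y k)) = (\<Sum>k<r. x k * y k)"
proof -
  have "(\<Sum>i<n. (\<Sum>k<r. A (i, k) * x k) * (\<Sum>k<r. A (i, k) * y k))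
      = (\<Sum>i<n. \<Sum>k<r. \<Sum>l<r. x k * y l * (A (i, k) * A (i, l)))"
    by (simp add: sum_product mult_ac)
  also have "\<dots> = (\<Sum>k<r. \<Sum>l<r. \<Sum>i<n. x k * y l * (A (i, k) * A (i, l)))"
    by (subst sum.swap, rule sum.cong[OF refl], rule sum.swap)
  also have "\<dots> = (\<Sum>k<r. \<Sum>l<r. x k * y l * (if k = l then 1 else 0))"
    by (intro sum.cong refl) (simp add: sum_distrib_left[symmetric] orthonormal_colsD[OF assms])
  also have "\<dots> = (\<Sum>k<r. x k * y k)"
    by (simp add: if_distrib cong: if_cong)
  finally show ?thesis .
qed

lemma L2_set_orthonormal_cols:
  assumes "orthonormal_cols n r A"
  shows "L2_set (\<lambda>i. \<Sum>k<r. A (i, k) * x k) {..<n} = L2_set x {..<r}"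
  using inner_orthonormal_cols[OF assms, of x x] by (simp add: L2_set_def power2_eq_square)

lemma sum_power2_orthonormal_cols:
  assumes "orthonormal_cols n r A"
  shows "(\<Sum>k<n. \<Sum>a<r. (A (k, a))\<^sup>2) = r"
proof -
  have "(\<Sum>k<n. \<Sum>a<r. (A (k, a))\<^sup>2) = (\<Sum>a<r. \<Sum>k<n. A (k, a) * A (k, a))"
    by (subst sum.swap) (simp add: power2_eq_square)
  also have "\<dots> = r"
    by (simp add: orthonormal_colsD[OF assms])
  finally show ?thesis .
qed

definition append_col :: "nat \<Rightarrow> mat \<Rightarrow> (nat \<Rightarrow> real) \<Rightarrow> mat" where
  "append_col i A v = (\<lambda>(k, a). if a < i then A (k, a) else v k)"

lemma orthonormal_cols_append_col:
  assumes A: "orthonormal_cols n i A"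
    and orth: "\<And>a. a < i \<Longrightarrow> (\<Sum>k<n. A (k, a) * v k) = 0" and unit: "L2_set v {..<n} = 1"
  shows "orthonormal_cols n (Suc i) (append_col i A v)"
proof -
  have "(\<Sum>k<n. v k * v k) = 1"
    using unit L2_set_power2[of v "{..<n}"] by (simp add: power2_eq_square)
  moreover have "(\<Sum>k<n. v k * A (k, a)) = 0" if "a < i" for a
    using orth[OF that] by (simp add: mult.commute)
  ultimately show ?thesis
    using orth A by (auto simp: orthonormal_cols_def append_col_def less_Suc_eq)
qed

definition unit_vec_residual :: "nat \<Rightarrow> mat \<Rightarrow> nat \<Rightarrow> nat \<Rightarrow> real" where
  "unit_vec_residual i A k l = (if l = k then 1 else 0) - (\<Sum>a<i. A (k, a) * A (l, a))"

lemma unit_vec_residual_orthogonal: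
  assumes A: "orthonormal_cols n i A" and "k < n" "b < i"
  shows "(\<Sum>l<n. A (l, b) * unit_vec_residual i A k l) = 0"
proof -
  have "(\<Sum>l<n. A (l, b) * (\<Sum>a<i. A (k, a) * A (l, a)))
      = (\<Sum>a<i. A (k, a) * (\<Sum>l<n. A (l, b) * A (l, a)))"
    unfolding sum_distrib_left by (subst sum.swap) (simp add: mult_ac)
  also have "\<dots> = (\<Sum>a<i. A (k, a) * (if b = a then 1 else 0))"
    using \<open>b < i\<close> by (simp add: orthonormal_colsD[OF A])
  also have "\<dots> = A (k, b)"
    using \<open>b < i\<close> by (simp add: if_distrib cong: if_cong)
  finally show ?thesis
    using \<open>k < n\<close> unfolding unit_vec_residual_def right_diff_distrib sum_subtractf
    by (simp add: if_distrib cong: if_cong)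
qed

lemma sum_unit_vec_residual_power2:
  assumes "orthonormal_cols n i A" "k < n"
  shows "(\<Sum>l<n. (unit_vec_residual i A k l)\<^sup>2) = 1 - (\<Sum>a<i. (A (k, a))\<^sup>2)"
proof -
  let ?w = "unit_vec_residual i A k"
  have "(\<Sum>l<n. (?w l)\<^sup>2)
      = (\<Sum>l<n. (if l = k then 1 else 0) * ?w l) - (\<Sum>l<n. (\<Sum>a<i. A (k, a) * A (l, a)) * ?w l)"
    by (simp add: sum_subtractf[symmetric] left_diff_distrib[symmetric] power2_eq_square
        flip: unit_vec_residual_def)
  also have "(\<Sum>l<n. (\<Sum>a<i. A (k, a) * A (l, a)) * ?w l)
      = (\<Sum>a<i. A (k, a) * (\<Sum>l<n. A (l, a) * ?w l))"
    unfolding sum_distrib_right sum_distrib_left by (subst sum.swap) (simp add: mult_ac)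
  also have "\<dots> = 0"
    by (simp add: unit_vec_residual_orthogonal[OF assms])
  also have "(\<Sum>l<n. (if l = k then 1 else 0) * ?w l) = ?w k"
    using \<open>k < n\<close> by (simp add: if_distrib[where f="\<lambda>c. c * _"] cong: if_cong)
  finally show ?thesis
    by (simp add: unit_vec_residual_def power2_eq_square)
qed

lemma orthonormal_cols_extend_one:
  assumes A: "orthonormal_cols n i A" and "i < n"
  shows "\<exists>v. orthonormal_cols n (Suc i) (append_col i A v)"
proof -
  have "\<exists>k<n. (\<Sum>a<i. (A (k, a))\<^sup>2) < 1"
  proof (rule ccontr)
    assume "\<not> ?thesis"
    then have "(\<Sum>k<n. 1) \<le> (\<Sum>k<n. \<Sum>a<i. (A (k, a))\<^sup>2)"
      by (intro sum_mono) (meson lessThan_iff not_less)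
    then show False
      using \<open>i < n\<close> by (simp add: sum_power2_orthonormal_cols[OF A])
  qed
  then obtain k where k: "k < n" "(\<Sum>a<i. (A (k, a))\<^sup>2) < 1" by blast
  define s where "s = L2_set (unit_vec_residual i A k) {..<n}"
  define v where "v = (\<lambda>l. unit_vec_residual i A k l * (1 / s))"
  have "0 < s"
    using k by (simp add: s_def L2_set_def sum_unit_vec_residual_power2[OF A])
  then have "L2_set v {..<n} = 1"
    unfolding v_def by (subst L2_set_left_distrib[symmetric]) (simp_all add: s_def)
  moreover have "(\<Sum>l<n. A (l, a) * v l) = 0" if "a < i" for a
    using unit_vec_residual_orthogonal[OF A k(1) that]
    by (simp add: v_def flip: sum_divide_distrib)
  ultimately have "orthonormal_cols n (Suc i) (append_col i A v)"
    by (intro orthonormal_cols_append_col[OF A])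
  then show ?thesis by (intro exI)
qed

lemma orthonormal_cols_extend:
  assumes "orthonormal_cols n i A" "i \<le> j" "j \<le> n"
  shows "\<exists>B. orthonormal_cols n j B \<and> (\<forall>k. \<forall>a<i. B (k, a) = A (k, a))"
  using assms(2,3)
proof (induction j rule: dec_induct)
  case base
  then show ?case using assms(1) by auto
next
  case (step j)
  then obtain B where B: "orthonormal_cols n j B" "\<forall>k. \<forall>a<i. B (k, a) = A (k, a)" by auto
  then obtain v where "orthonormal_cols n (Suc j) (append_col j B v)"
    using orthonormal_cols_extend_one step.prems by (metis Suc_le_eq)
  then show ?case
    using B(2) step.hyps by (intro exI[of _ "append_col j B v"]) (auto simp: append_col_def)
qed

definition orth_completion :: "nat \<Rightarrow> nat \<Rightarrow> mat \<Rightarrow> mat" where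
  "orth_completion n i A =
     (SOME B. orthonormal_cols n n B \<and> (\<forall>k. \<forall>a<i. B (k, a) = A (k, a)))"

lemma orth_completion:
  assumes "orthonormal_cols n i A" "i \<le> n"
  shows orthonormal_cols_completion: "orthonormal_cols n n (orth_completion n i A)"
    and orth_completion_eq: "a < i \<Longrightarrow> orth_completion n i A (k, a) = A (k, a)"
  using someI_ex[OF orthonormal_cols_extend[OF assms order_refl]]
  by (auto simp: orth_completion_def)

section \<open>The orthogonal group\<close>

lemma orthonormal_rows_of_square:
  assumes A: "orthonormal_cols r r A" and "k < r" "l < r"
  shows "(\<Sum>a<r. A (k, a) * A (l, a)) = (if k = l then 1 else 0)"
proof -
  have "(\<Sum>k<r. \<Sum>l<r. (unit_vec_residual r A k l)\<^sup>2) = (\<Sum>k<r. 1 - (\<Sum>a<r. (A (k, a))\<^sup>2))"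
    by (simp add: sum_unit_vec_residual_power2[OF A])
  also have "\<dots> = 0"
    by (simp add: sum_subtractf sum_power2_orthonormal_cols[OF A])
  finally have "(\<Sum>l<r. (unit_vec_residual r A k l)\<^sup>2) = 0"
    using \<open>k < r\<close> by (subst (asm) sum_nonneg_eq_0_iff) (auto intro: sum_nonneg)
  then have "unit_vec_residual r A k l = 0"
    using \<open>l < r\<close> by (subst (asm) sum_nonneg_eq_0_iff) auto
  then show ?thesis
    by (auto simp: unit_vec_residual_def split: if_splits)
qed

definition transpose_mat :: "mat \<Rightarrow> mat" where
  "transpose_mat A = (\<lambda>(i, j). A (j, i))"

definition id_mat :: mat where
  "id_mat = (\<lambda>(i, j). if i = j then 1 else 0)"

lemma id_mat_in_orth_group: "id_mat \<in> orth_group r"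
proof -
  have "(\<Sum>k<r. id_mat (k, a) * id_mat (k, b)) = (\<Sum>k<r. if k = a then id_mat (k, b) else 0)" for a b
    by (intro sum.cong) (auto simp: id_mat_def)
  then show ?thesis
    by (auto simp: orth_group_def orthonormal_cols_def) (auto simp: id_mat_def)
qed

lemma transpose_mat_in_orth_group: "A \<in> orth_group r \<Longrightarrow> transpose_mat A \<in> orth_group r"
  using orthonormal_rows_of_square[of r A]
  by (simp add: orth_group_def orthonormal_cols_def[of r r "transpose_mat A"])
    (simp add: transpose_mat_def)

lemma mat_mult_in_orth_group:
  assumes "A \<in> orth_group r" "B \<in> orth_group r"
  shows "mat_mult r A B \<in> orth_group r"
  using assms inner_orthonormal_cols[of r r A]
  by (simp add: orth_group_def mat_mult_def orthonormal_cols_def[where A="\<lambda>(i, j). _ i j"]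
      orthonormal_colsD)

lemma mat_mult_assoc: "mat_mult r (mat_mult r A B) C = mat_mult r A (mat_mult r B C)"
proof -
  have "(\<Sum>l<r. (\<Sum>k<r. A (i, k) * B (k, l)) * C (l, j))
      = (\<Sum>k<r. A (i, k) * (\<Sum>l<r. B (k, l) * C (l, j)))" for i j
    unfolding sum_distrib_left sum_distrib_right by (subst sum.swap) (simp add: mult_ac)
  then show ?thesis by (simp add: mat_mult_def)
qed

lemma mat_mult_diff_left: "mat_mult r (A - B) C = mat_mult r A C - mat_mult r B C"
  by (auto simp: mat_mult_def left_diff_distrib sum_subtractf)

lemma mat_mult_diff_right: "mat_mult r A (B - C) = mat_mult r A B - mat_mult r A C"
  by (auto simp: mat_mult_def right_diff_distrib sum_subtractf)

lemma mat_mult_id_right: "j < r \<Longrightarrow> mat_mult r A id_mat (i, j) = A (i, j)"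
  by (simp add: mat_mult_def id_mat_def if_distrib cong: if_cong)

lemma mat_mult_transpose_cancel:
  assumes "G \<in> orth_group r" "l < r"
  shows "mat_mult r G (mat_mult r (transpose_mat G) H) (l, j) = H (l, j)"
proof -
  have "mat_mult r G (mat_mult r (transpose_mat G) H) (l, j)
      = (\<Sum>m<r. (\<Sum>k<r. G (l, k) * G (m, k)) * H (m, j))"
    unfolding mat_mult_assoc[symmetric] by (simp add: mat_mult_def transpose_mat_def)
  also have "\<dots> = (\<Sum>m<r. if m = l then H (m, j) else 0)"
    using assms by (intro sum.cong) (auto simp: orth_group_def orthonormal_rows_of_square)
  finally show ?thesis using \<open>l < r\<close> by simp
qed

lemma mat_mult_mult_transpose:
  assumes "G \<in> orth_group r"
  shows "mat_mult r (mat_mult r V G) (mat_mult r (transpose_mat G) H) = mat_mult r V H"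
  unfolding mat_mult_assoc
  by (auto simp: mat_mult_def[of r V] mat_mult_transpose_cancel[OF assms] fun_eq_iff)

definition row_norm :: "nat \<Rightarrow> mat \<Rightarrow> nat \<Rightarrow> real" where
  "row_norm r A i = L2_set (\<lambda>j. A (i, j)) {..<r}"

lemma row_norm_diff_le: "row_norm r (A - B) i \<le> row_norm r A i + row_norm r B i"
  by (simp add: row_norm_def L2_set_diff_le)

lemma row_norm_mat_mult:
  assumes "Q \<in> orth_group r"
  shows "row_norm r (mat_mult r A Q) i = row_norm r A i"
  using L2_set_orthonormal_cols[of r r "transpose_mat Q" "\<lambda>k. A (i, k)"]
    transpose_mat_in_orth_group[OF assms]
  by (simp add: row_norm_def orth_group_def mat_mult_def transpose_mat_def mult.commute)

lemma row_norm_orth_group: "A \<in> orth_group r \<Longrightarrow> i < r \<Longrightarrow> row_norm r A i = 1"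
  using orthonormal_rows_of_square[of r A i i]
  by (simp add: row_norm_def L2_set_def orth_group_def power2_eq_square)

definition frob_norm :: "nat \<Rightarrow> mat \<Rightarrow> real" where
  "frob_norm r A = L2_set A ({..<r} \<times> {..<r})"

lemma frob_norm_nonneg: "0 \<le> frob_norm r A"
  by (simp add: frob_norm_def)

lemma frob_norm_diff_le: "frob_norm r (A - B) \<le> frob_norm r A + frob_norm r B"
  using L2_set_diff_le[of A B] by (simp add: frob_norm_def fun_diff_def)

lemma frob_norm_minus_commute: "frob_norm r (A - B) = frob_norm r (B - A)"
  by (simp add: frob_norm_def L2_set_def power2_commute)

lemma frob_norm_power2_rows: "(frob_norm r A)\<^sup>2 = (\<Sum>i<r. (row_norm r A i)\<^sup>2)"
  by (simp add: frob_norm_def row_norm_def L2_set_power2 sum.cartesian_product)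

lemma frob_norm_power2_cols: "(frob_norm r A)\<^sup>2 = (\<Sum>j<r. (L2_set (\<lambda>i. A (i, j)) {..<r})\<^sup>2)"
  unfolding frob_norm_power2_rows row_norm_def L2_set_power2 by (rule sum.swap)

lemma frob_norm_mat_mult:
  assumes "A \<in> orth_group r"
  shows "frob_norm r (mat_mult r A B) = frob_norm r B"
proof (rule power2_eq_imp_eq)
  have "L2_set (\<lambda>i. mat_mult r A B (i, j)) {..<r} = L2_set (\<lambda>i. B (i, j)) {..<r}" for j
    using assms L2_set_orthonormal_cols[of r r A "\<lambda>k. B (k, j)"]
    by (simp add: mat_mult_def orth_group_def)
  then show "(frob_norm r (mat_mult r A B))\<^sup>2 = (frob_norm r B)\<^sup>2"
    by (simp add: frob_norm_power2_cols)
qed (rule frob_norm_nonneg)+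

lemma frob_norm_le_rows:
  assumes "\<And>i. i < r \<Longrightarrow> row_norm r A i \<le> c" "0 \<le> c"
  shows "frob_norm r A \<le> sqrt r * c"
proof (rule power2_le_imp_le)
  have "(frob_norm r A)\<^sup>2 \<le> (\<Sum>i<r. c\<^sup>2)"
    unfolding frob_norm_power2_rows
    using assms by (intro sum_mono power_mono) (auto simp: row_norm_def)
  then show "(frob_norm r A)\<^sup>2 \<le> (sqrt r * c)\<^sup>2"
    by (simp add: power_mult_distrib)
qed (use assms in simp)

section \<open>The distance up to rotation\<close>

lemma norm_2inf_eq_Max_row_norm: "norm_2inf n r A = Max (row_norm r A ` {..<n})"
  by (simp add: norm_2inf_def row_norm_def[abs_def] L2_set_def)

lemma norm_2inf_le_iff: "0 < n \<Longrightarrow> norm_2inf n r A \<le> c \<longleftrightarrow> (\<forall>i<n. row_norm r A i \<le> c)"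
  unfolding norm_2inf_eq_Max_row_norm by (subst Max_le_iff) auto

lemma norm_2inf_less_iff: "0 < n \<Longrightarrow> norm_2inf n r A < c \<longleftrightarrow> (\<forall>i<n. row_norm r A i < c)"
  unfolding norm_2inf_eq_Max_row_norm by (subst Max_less_iff) auto

lemma norm_2inf_nonneg:
  assumes "0 < n"
  shows "0 \<le> norm_2inf n r A"
proof -
  have "0 \<le> row_norm r A 0"
    by (simp add: row_norm_def)
  also have "\<dots> \<le> norm_2inf n r A"
    using norm_2inf_le_iff[OF assms, of r A "norm_2inf n r A"] assms by simp
  finally show ?thesis .
qed

lemma d_2inf_eq_INF: "d_2inf n r U1 U2 = (INF G\<in>orth_group r. norm_2inf n r (U2 - mat_mult r U1 G))"
  by (simp add: d_2inf_def fun_diff_def)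

lemma d_2inf_less_iff:
  assumes "0 < n"
  shows "d_2inf n r U1 U2 < c \<longleftrightarrow> (\<exists>G\<in>orth_group r. norm_2inf n r (U2 - mat_mult r U1 G) < c)"
  unfolding d_2inf_eq_INF
proof (rule cINF_less_iff)
  show "orth_group r \<noteq> {}"
    using id_mat_in_orth_group by blast
  show "bdd_below ((\<lambda>G. norm_2inf n r (U2 - mat_mult r U1 G)) ` orth_group r)"
    using norm_2inf_nonneg[OF assms] by (rule bdd_belowI2)
qed

lemma d_2inf_greatest:
  assumes "\<And>G. G \<in> orth_group r \<Longrightarrow> c \<le> norm_2inf n r (U2 - mat_mult r U1 G)"
  shows "c \<le> d_2inf n r U1 U2"
  unfolding d_2inf_eq_INF using id_mat_in_orth_group assms by (intro cINF_greatest) auto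

lemma d_2inf_triangle_less:
  assumes "0 < n" "d_2inf n r V U1 < a" "d_2inf n r V U2 < b"
  shows "d_2inf n r U1 U2 < a + b"
proof -
  obtain G H where G: "G \<in> orth_group r" "norm_2inf n r (U1 - mat_mult r V G) < a"
    and H: "H \<in> orth_group r" "norm_2inf n r (U2 - mat_mult r V H) < b"
    using assms by (auto simp: d_2inf_less_iff)
  define Q where "Q = mat_mult r (transpose_mat G) H"
  have Q: "Q \<in> orth_group r"
    using G H by (simp add: Q_def mat_mult_in_orth_group transpose_mat_in_orth_group)
  have VGQ: "mat_mult r (mat_mult r V G) Q = mat_mult r V H"
    unfolding Q_def by (rule mat_mult_mult_transpose[OF G(1)])
  have "row_norm r (U2 - mat_mult r U1 Q) i < a + b" if "i < n" for i
  proof -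
    have "U2 - mat_mult r U1 Q = (U2 - mat_mult r V H) - mat_mult r (U1 - mat_mult r V G) Q"
      by (simp add: mat_mult_diff_left VGQ fun_eq_iff)
    then have "row_norm r (U2 - mat_mult r U1 Q) i
        \<le> row_norm r (U2 - mat_mult r V H) i + row_norm r (U1 - mat_mult r V G) i"
      using row_norm_diff_le by (metis row_norm_mat_mult[OF Q])
    also have "\<dots> < b + a"
      using G(2) H(2) that assms(1) by (intro add_strict_mono) (simp_all add: norm_2inf_less_iff)
    finally show ?thesis by simp
  qed
  then show ?thesis
    using Q assms(1) by (auto simp: d_2inf_less_iff norm_2inf_less_iff)
qed

lemma d_2inf_self_less:
  assumes "0 < n" "0 < c"
  shows "d_2inf n r U U < c"
proof -
  have "row_norm r (U - mat_mult r U id_mat) i < c" for i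
    using \<open>0 < c\<close> by (simp add: row_norm_def L2_set_def mat_mult_id_right)
  then show ?thesis
    using id_mat_in_orth_group \<open>0 < n\<close> by (auto simp: d_2inf_less_iff norm_2inf_less_iff)
qed

text \<open>Being an infimum over an uncountable group, \<open>d_2inf\<close> owes its measurability to upper
  semicontinuity.\<close>

lemma open_d_2inf_less:
  assumes "0 < n"
  shows "open {V. d_2inf n r V U < c}"
proof -
  have "{V. d_2inf n r V U < c}
      = (\<Union>G\<in>orth_group r. \<Inter>i\<in>{..<n}. {V. row_norm r (U - mat_mult r V G) i < c})"
    using assms by (auto simp: d_2inf_less_iff norm_2inf_less_iff)
  also have "open \<dots>"
    by (intro open_UN ballI open_INT finite_lessThan open_Collect_less)
      (auto simp: row_norm_def L2_set_def mat_mult_def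
        intro!: continuous_intros continuous_on_product_coordinates)
  finally show ?thesis .
qed

lemma measurable_PiM_borel_ident:
  "(\<lambda>x. x) \<in> (\<Pi>\<^sub>M i\<in>I. (borel :: 'b::second_countable_topology measure))
    \<rightarrow>\<^sub>M (borel :: ('i::countable \<Rightarrow> 'b) measure)"
proof -
  have "(\<lambda>x. x) \<in> (\<Pi>\<^sub>M i\<in>I. borel) \<rightarrow>\<^sub>M (\<Pi>\<^sub>M i\<in>UNIV. (borel :: 'b measure))"
  proof (rule measurable_PiM_single')
    show "(\<lambda>x. x i) \<in> (\<Pi>\<^sub>M i\<in>I. borel) \<rightarrow>\<^sub>M (borel :: 'b measure)" for i
    proof (cases "i \<in> I")
      case False
      then have "x i = undefined" if "x \<in> space (\<Pi>\<^sub>M i\<in>I. (borel :: 'b measure))" for x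
        using that by (auto simp: space_PiM PiE_iff extensional_def)
      then show ?thesis by (subst measurable_cong[where g="\<lambda>_. undefined"]) auto
    qed (rule measurable_component_singleton)
  qed auto
  then show ?thesis
    by (simp only: measurable_cong_sets[OF refl sets_PiM_equal_borel])
qed

lemma borel_measurable_d_2inf:
  assumes "0 < n"
  shows "(\<lambda>V. d_2inf n r V U) \<in> borel_measurable (est_space m k)"
proof -
  have "(\<lambda>V. d_2inf n r V U) \<in> borel_measurable borel"
    unfolding borel_measurable_iff_less using open_d_2inf_less[OF assms] by simp
  from measurable_compose[OF measurable_PiM_borel_ident this] show ?thesis
    by (simp add: est_space_def)
qed

section \<open>A packing of the orthogonal group\<close>

lemma ex_separated_subset:
  fixes N :: real
  assumes "finite J"
    and refl: "\<And>x. x \<in> J \<Longrightarrow> near x x"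
    and sym: "\<And>x y. near x y \<Longrightarrow> near y x"
    and ball: "\<And>x. x \<in> J \<Longrightarrow> card {y \<in> J. near x y} \<le> N"
  shows "\<exists>F\<subseteq>J. pairwise (\<lambda>x y. \<not> near x y) F \<and> card J \<le> N * card F"
proof -
  let ?sep = "{F. F \<subseteq> J \<and> pairwise (\<lambda>x y. \<not> near x y) F}"
  have "finite ?sep" "{} \<in> ?sep"
    using \<open>finite J\<close> by simp_all
  then obtain F where F: "F \<in> ?sep" and maximal: "\<And>G. G \<in> ?sep \<Longrightarrow> F \<subseteq> G \<Longrightarrow> F = G"
    using finite_has_maximal[of ?sep] by (metis (no_types, lifting) empty_iff)
  have "finite F"
    using F \<open>finite J\<close> finite_subset by auto
  have "\<exists>x\<in>F. near x y" if "y \<in> J" for y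
  proof (rule ccontr)
    assume far: "\<not> ?thesis"
    then have "\<not> near x y \<and> \<not> near y x" if "x \<in> F" for x
      using that sym by blast
    then have "insert y F \<in> ?sep"
      using F \<open>y \<in> J\<close> by (auto simp: pairwise_insert)
    then have "y \<in> F"
      using maximal[of "insert y F"] by blast
    then show False
      using far refl[OF \<open>y \<in> J\<close>] by blast
  qed
  then have "J \<subseteq> (\<Union>x\<in>F. {y \<in> J. near x y})"
    by blast
  then have "card J \<le> card (\<Union>x\<in>F. {y \<in> J. near x y})"
    using \<open>finite J\<close> \<open>finite F\<close> by (intro card_mono) auto
  also have "\<dots> \<le> (\<Sum>x\<in>F. card {y \<in> J. near x y})"
    by (rule card_UN_le[OF \<open>finite F\<close>])
  finally have "card J \<le> (\<Sum>x\<in>F. real (card {y \<in> J. near x y}))"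
    by (simp flip: of_nat_sum)
  also have "\<dots> \<le> (\<Sum>x\<in>F. N)"
    using F ball by (intro sum_mono) auto
  finally show ?thesis
    using F by (auto simp: mult.commute)
qed

text \<open>Lists grow at the front, so \<open>xs\<close> is the history against which the next letter is judged.\<close>

primrec misses :: "('a list \<Rightarrow> 'a \<Rightarrow> bool) \<Rightarrow> 'a list \<Rightarrow> nat" where
  "misses hit [] = 0"
| "misses hit (x # xs) = misses hit xs + (if hit xs x then 0 else 1)"

lemma sum_power_misses_le:
  fixes x K :: real
  assumes "finite A" "0 \<le> x" "0 \<le> K"
    and few: "\<And>xs. set xs \<subseteq> A \<Longrightarrow> length xs < m \<Longrightarrow> card {a \<in> A. hit xs a} \<le> K"
  shows "(\<Sum>xs | set xs \<subseteq> A \<and> length xs = m. x ^ misses hit xs) \<le> (K + card A * x) ^ m"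
  using few
proof (induction m)
  case 0
  have "{xs :: 'a list. set xs \<subseteq> A \<and> length xs = 0} = {[]}" by auto
  then show ?case by simp
next
  case (Suc m)
  let ?L = "\<lambda>m. {xs. set xs \<subseteq> A \<and> length xs = m}"
  have next_letter: "(\<Sum>a\<in>A. x ^ misses hit (a # xs)) \<le> x ^ misses hit xs * (K + card A * x)"
    if "xs \<in> ?L m" for xs
  proof -
    have "(\<Sum>a\<in>A. x ^ misses hit (a # xs)) = x ^ misses hit xs * (\<Sum>a\<in>A. if hit xs a then 1 else x)"
      unfolding sum_distrib_left by (intro sum.cong) auto
    also have "(\<Sum>a\<in>A. if hit xs a then 1 else x)
        = card {a \<in> A. hit xs a} + card {a \<in> A. \<not> hit xs a} * x"
    proof -
      have "A \<inter> {a. hit xs a} = {a \<in> A. hit xs a}" "A \<inter> - {a. hit xs a} = {a \<in> A. \<not> hit xs a}"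
        by auto
      then show ?thesis using \<open>finite A\<close> by (simp add: sum.If_cases)
    qed
    also have "\<dots> \<le> K + card A * x"
      using Suc.prems[of xs] that \<open>finite A\<close> \<open>0 \<le> x\<close>
      by (intro add_mono mult_right_mono) (auto intro: card_mono)
    finally show ?thesis
      using \<open>0 \<le> x\<close> by (simp add: mult_left_mono)
  qed
  have "(\<Sum>ys\<in>?L (Suc m). x ^ misses hit ys) = (\<Sum>xs\<in>?L m. \<Sum>a\<in>A. x ^ misses hit (a # xs))"
    unfolding lists_length_Suc_eq
    by (subst sum.reindex) (auto simp: inj_on_def sum.cartesian_product intro!: sum.cong)
  also have "\<dots> \<le> (\<Sum>xs\<in>?L m. x ^ misses hit xs) * (K + card A * x)"
    unfolding sum_distrib_right by (intro sum_mono next_letter)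
  also have "\<dots> \<le> (K + card A * x) ^ m * (K + card A * x)"
    using Suc assms(2,3) by (intro mult_right_mono) auto
  finally show ?case by (simp only: power_Suc2)
qed

lemma card_few_misses_le:
  fixes K :: real
  assumes "finite A" "0 < K" "K \<le> card A"
    and few: "\<And>xs. set xs \<subseteq> A \<Longrightarrow> length xs < m \<Longrightarrow> card {a \<in> A. hit xs a} \<le> K"
  shows "card {xs. set xs \<subseteq> A \<and> length xs = m \<and> 2 * misses hit xs \<le> m}
    \<le> (2 * sqrt (K * card A)) ^ m"
    (is "real (card ?S) \<le> _")
proof -
  define x where "x = K / card A"
  have x: "0 < x" "x \<le> 1" "card A * x = K"
    using assms(2,3) by (auto simp: x_def)
  have "sqrt x ^ m \<le> x ^ misses hit xs" if "xs \<in> ?S" for xs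
  proof -
    have "sqrt x ^ m \<le> sqrt x ^ (2 * misses hit xs)"
      using that x by (intro power_decreasing) auto
    also have "\<dots> = x ^ misses hit xs"
      using x by (simp add: power_mult)
    finally show ?thesis .
  qed
  then have "card ?S * sqrt x ^ m \<le> (\<Sum>xs\<in>?S. x ^ misses hit xs)"
    using sum_mono[of ?S "\<lambda>_. sqrt x ^ m"] by simp
  also have "\<dots> \<le> (\<Sum>xs | set xs \<subseteq> A \<and> length xs = m. x ^ misses hit xs)"
    using x by (intro sum_mono2 finite_lists_length_eq[OF \<open>finite A\<close>]) auto
  also have "\<dots> \<le> (2 * K) ^ m"
    using sum_power_misses_le[where x=x and hit=hit, OF assms(1) _ _ few] x \<open>0 < K\<close> by simp
  also have "2 * K = 2 * sqrt (K * card A) * sqrt x"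
    using assms(2,3) by (simp add: x_def flip: real_sqrt_mult)
  also have "\<dots> ^ m = (2 * sqrt (K * card A)) ^ m * sqrt x ^ m"
    by (rule power_mult_distrib)
  finally show ?thesis
    using x by (auto dest: mult_right_le_imp_le)
qed

lemma card_small_subsets_le:
  assumes "finite A"
  shows "card {Z. Z \<subseteq> A \<and> 8 * card Z < card A} \<le> 2 powr (3 * real (card A) / 4)"
    (is "real (card ?S) \<le> _")
proof -
  let ?d = "real (card A)"
  have "2 powr (- ?d / 4) \<le> (1/4) ^ card Z" if "Z \<in> ?S" for Z
  proof -
    have "2 powr (- ?d / 4) \<le> (2 powr (- 2)) powr real (card Z)"
      unfolding powr_powr using that by (intro powr_mono) auto
    also have "\<dots> = (1/4) ^ card Z"
      by (simp add: powr_realpow powr_minus_divide)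
    finally show ?thesis .
  qed
  then have "card ?S * 2 powr (- ?d / 4) \<le> (\<Sum>Z\<in>?S. (1/4) ^ card Z)"
    using sum_mono[of ?S "\<lambda>_. 2 powr (- ?d / 4)"] by simp
  also have "\<dots> \<le> (\<Sum>Z\<in>Pow A. (1/4) ^ card Z)"
    using assms by (intro sum_mono2) auto
  also have "\<dots> = (\<Prod>j\<in>A. 1/4 + 1)"
    using assms by (subst prod_add) auto
  also have "\<dots> \<le> (2 powr (1/2)) ^ card A"
  proof -
    have "5/4 \<le> sqrt (2 :: real)"
      by (rule real_le_rsqrt) (simp add: power2_eq_square)
    then show ?thesis
      by (simp add: powr_half_sqrt power_mono)
  qed
  also have "\<dots> = 2 powr (3 * ?d / 4) * 2 powr (- ?d / 4)"
    by (simp add: powr_powr flip: powr_realpow powr_add)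
  finally show ?thesis by simp
qed

definition sign_vec :: "nat \<Rightarrow> nat set \<Rightarrow> nat \<Rightarrow> real" where
  "sign_vec d E j = (if j \<in> E then 1 else -1) / sqrt d"

lemma L2_set_sign_vec:
  assumes "0 < d"
  shows "L2_set (sign_vec d E) {..<d} = 1"
proof -
  have "(sign_vec d E j)\<^sup>2 = 1 / d" for j
    by (simp add: sign_vec_def power_divide)
  then show ?thesis
    using assms by (simp add: L2_set_def)
qed

lemma L2_set_sign_vec_diff:
  assumes "0 < d" "E \<subseteq> {..<d}" "E' \<subseteq> {..<d}"
  shows "(L2_set (\<lambda>j. sign_vec d E j - sign_vec d E' j) {..<d})\<^sup>2 = 4 * card (sym_diff E E') / d"
proof -
  have "(L2_set (\<lambda>j. sign_vec d E j - sign_vec d E' j) {..<d})\<^sup>2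
      = (\<Sum>j<d. if j \<in> sym_diff E E' then 4 / d else 0)"
    unfolding L2_set_power2 using \<open>0 < d\<close>
    by (intro sum.cong) (auto simp: sign_vec_def power2_eq_square divide_simps)
  also have "\<dots> = (\<Sum>j\<in>{..<d} \<inter> sym_diff E E'. 4 / d)"
    by (rule sum.inter_restrict[symmetric]) simp
  also have "{..<d} \<inter> sym_diff E E' = sym_diff E E'"
    using assms by auto
  finally show ?thesis by simp
qed

definition sign_comb :: "nat \<Rightarrow> nat \<Rightarrow> mat \<Rightarrow> nat set \<Rightarrow> nat \<Rightarrow> real" where
  "sign_comb i d B E k = (\<Sum>j<d. B (k, i + j) * sign_vec d E j)"

lemma orthonormal_cols_shift:
  "orthonormal_cols n n B \<Longrightarrow> i + d \<le> n \<Longrightarrow> orthonormal_cols n d (\<lambda>(k, j). B (k, i + j))"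
  by (simp add: orthonormal_cols_def)

lemma sign_comb_orthogonal:
  assumes B: "orthonormal_cols n n B" and "i + d \<le> n" "a < i"
  shows "(\<Sum>k<n. B (k, a) * sign_comb i d B E k) = 0"
proof -
  have "(\<Sum>k<n. B (k, a) * sign_comb i d B E k)
      = (\<Sum>j<d. (\<Sum>k<n. B (k, a) * B (k, i + j)) * sign_vec d E j)"
    unfolding sign_comb_def sum_distrib_left sum_distrib_right
    by (subst sum.swap) (simp add: mult_ac)
  also have "\<dots> = 0"
    using assms by (intro sum.neutral) (simp add: orthonormal_colsD[OF B])
  finally show ?thesis .
qed

lemma L2_set_sign_comb:
  assumes "orthonormal_cols n n B" "i + d \<le> n" "0 < d"
  shows "L2_set (sign_comb i d B E) {..<n} = 1"
  using L2_set_orthonormal_cols[OF orthonormal_cols_shift[OF assms(1,2)], of "sign_vec d E"]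
  by (simp add: sign_comb_def[abs_def] L2_set_sign_vec[OF \<open>0 < d\<close>])

lemma L2_set_sign_comb_diff:
  assumes "orthonormal_cols n n B" "i + d \<le> n"
  shows "L2_set (\<lambda>k. sign_comb i d B E k - sign_comb i d B E' k) {..<n}
    = L2_set (\<lambda>j. sign_vec d E j - sign_vec d E' j) {..<d}"
  using L2_set_orthonormal_cols[OF orthonormal_cols_shift[OF assms],
      of "\<lambda>j. sign_vec d E j - sign_vec d E' j"]
  by (simp add: sign_comb_def right_diff_distrib sum_subtractf)

lemma card_sign_comb_ball_le:
  assumes B: "orthonormal_cols n n B" "i + d \<le> n" and "0 < d"
  shows "card {E \<in> Pow {..<d}. L2_set (\<lambda>k. sign_comb i d B E k - t k) {..<n} < 1/3}
    \<le> 2 powr (3 * real d / 4)"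
    (is "real (card ?S) \<le> _")
proof (cases "?S = {}")
  case True
  show ?thesis unfolding True by simp
next
  case False
  let ?Z = "{Z. Z \<subseteq> {..<d} \<and> 8 * card Z < card {..<d}}"
  from False obtain D where D: "D \<in> ?S" by blast
  have "sym_diff E D \<in> ?Z" if E: "E \<in> ?S" for E
  proof -
    have "4 * card (sym_diff E D) / d
        = (L2_set (\<lambda>k. sign_comb i d B E k - sign_comb i d B D k) {..<n})\<^sup>2"
      unfolding L2_set_sign_comb_diff[OF B]
      using E D \<open>0 < d\<close> by (intro L2_set_sign_vec_diff[symmetric]) auto
    also have "\<dots> \<le> (1/3 + 1/3)\<^sup>2"
      using L2_set_diff_le[of "\<lambda>k. sign_comb i d B E k - t k" "\<lambda>k. sign_comb i d B D k - t k" "{..<n}"]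
        E D by (intro power_mono) auto
    finally have "9 * card (sym_diff E D) \<le> d"
      using \<open>0 < d\<close> by (simp add: power2_eq_square field_simps)
    then have "8 * card (sym_diff E D) < d"
      using \<open>0 < d\<close> by linarith
    then show ?thesis using E D by auto
  qed
  moreover have "inj_on (\<lambda>E. sym_diff E D) ?S"
    by (auto simp: inj_on_def)
  ultimately have "card ?S \<le> card ?Z"
    by (intro card_inj_on_le[where f="\<lambda>E. sym_diff E D"]) auto
  then show ?thesis
    using card_small_subsets_le[of "{..<d}"] by simp
qed

text \<open>Orthonormal columns are chosen one after the other, the next one being a flat signed combination
  of \<open>d\<close> vectors that complete the columns chosen so far.\<close>

primrec sign_frame :: "nat \<Rightarrow> nat \<Rightarrow> nat set list \<Rightarrow> mat" where
  "sign_frame n d [] = (\<lambda>_. 0)"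
| "sign_frame n d (E # xs) = append_col (length xs) (sign_frame n d xs)
     (sign_comb (length xs) d (orth_completion n (length xs) (sign_frame n d xs)) E)"

lemma orthonormal_cols_sign_frame:
  assumes "length xs + d \<le> n" "0 < d"
  shows "orthonormal_cols n (length xs) (sign_frame n d xs)"
  using assms
proof (induction xs)
  case Nil
  then show ?case by (simp add: orthonormal_cols_def)
next
  case (Cons E xs)
  let ?A = "sign_frame n d xs" and ?i = "length xs"
  have A: "orthonormal_cols n ?i ?A" using Cons by simp
  have B: "orthonormal_cols n n (orth_completion n ?i ?A)"
    "\<And>a k. a < ?i \<Longrightarrow> ?A (k, a) = orth_completion n ?i ?A (k, a)"
    using orth_completion[OF A] Cons.prems by auto
  have "orthonormal_cols n (Suc ?i) (append_col ?i ?A (sign_comb ?i d (orth_completion n ?i ?A) E))"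
  proof (rule orthonormal_cols_append_col[OF A])
    show "(\<Sum>k<n. ?A (k, a) * sign_comb ?i d (orth_completion n ?i ?A) E k) = 0" if "a < ?i" for a
      using sign_comb_orthogonal[OF B(1) _ that, of d E] Cons.prems that by (simp add: B(2))
  qed (use L2_set_sign_comb[OF B(1)] Cons.prems in simp)
  then show ?case by simp
qed

definition frame_hit :: "nat \<Rightarrow> nat \<Rightarrow> mat \<Rightarrow> nat set list \<Rightarrow> nat set \<Rightarrow> bool" where
  "frame_hit n d T xs E \<longleftrightarrow>
     L2_set (\<lambda>k. sign_frame n d (E # xs) (k, length xs) - T (k, length xs)) {..<n} < 1/3"

lemma card_frame_hit_le:
  assumes "length xs + d \<le> n" "0 < d"
  shows "card {E \<in> Pow {..<d}. frame_hit n d T xs E} \<le> 2 powr (3 * real d / 4)"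
  unfolding frame_hit_def sign_frame.simps append_col_def
  using card_sign_comb_ball_le[OF _ assms, of "orth_completion n (length xs) (sign_frame n d xs)"]
    orthonormal_cols_completion[OF orthonormal_cols_sign_frame[OF assms]] assms(1)
  by simp

lemma misses_frame_hit_le:
  "misses (frame_hit n d T) xs / 9
    \<le> (\<Sum>a<length xs. (L2_set (\<lambda>k. sign_frame n d xs (k, a) - T (k, a)) {..<n})\<^sup>2)"
proof (induction xs)
  case (Cons E xs)
  let ?dist = "\<lambda>xs a. L2_set (\<lambda>k. sign_frame n d xs (k, a) - T (k, a)) {..<n}"
  have "(if frame_hit n d T xs E then 0 else 1) / 9 \<le> (?dist (E # xs) (length xs))\<^sup>2"
  proof (cases "frame_hit n d T xs E")
    case False
    then have "(1/3)\<^sup>2 \<le> (?dist (E # xs) (length xs))\<^sup>2"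
      by (intro power_mono) (auto simp: frame_hit_def not_less)
    with False show ?thesis by (simp add: power2_eq_square)
  qed simp
  moreover have "?dist (E # xs) a = ?dist xs a" if "a < length xs" for a
    using that by (simp add: append_col_def)
  ultimately have "misses (frame_hit n d T) xs / 9 + (if frame_hit n d T xs E then 0 else 1) / 9
      \<le> (\<Sum>a<length (E # xs). (?dist (E # xs) a)\<^sup>2)"
    using Cons by (simp add: add_mono del: sign_frame.simps)
  then show ?case
    by (cases "frame_hit n d T xs E") (simp_all add: add_divide_distrib del: sign_frame.simps)
qed simp

definition completed_frame :: "nat \<Rightarrow> nat \<Rightarrow> nat set list \<Rightarrow> mat" where
  "completed_frame n d xs = orth_completion n (length xs) (sign_frame n d xs)"

lemma completed_frame_in_orth_group:
  "length xs + d \<le> n \<Longrightarrow> 0 < d \<Longrightarrow> completed_frame n d xs \<in> orth_group n"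
  by (simp add: completed_frame_def orth_group_def orthonormal_cols_completion
      orthonormal_cols_sign_frame)

lemma misses_frame_hit_le_frob_norm:
  assumes "length xs + d \<le> n" "0 < d"
  shows "misses (frame_hit n d T) xs / 9 \<le> (frob_norm n (completed_frame n d xs - T))\<^sup>2"
proof -
  have "misses (frame_hit n d T) xs / 9
      \<le> (\<Sum>a<length xs. (L2_set (\<lambda>k. sign_frame n d xs (k, a) - T (k, a)) {..<n})\<^sup>2)"
    by (rule misses_frame_hit_le)
  also have "\<dots> = (\<Sum>a<length xs. (L2_set (\<lambda>k. (completed_frame n d xs - T) (k, a)) {..<n})\<^sup>2)"
    using orth_completion_eq[OF orthonormal_cols_sign_frame[OF assms]] assms(1)
    by (simp add: completed_frame_def)
  also have "\<dots> \<le> (frob_norm n (completed_frame n d xs - T))\<^sup>2"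
    unfolding frob_norm_power2_cols using assms by (intro sum_mono2) auto
  finally show ?thesis .
qed

lemma card_completed_frame_ball_le:
  assumes "m + d \<le> n" "0 < d"
  shows "card {xs. set xs \<subseteq> Pow {..<d} \<and> length xs = m
      \<and> (frob_norm n (completed_frame n d xs - T))\<^sup>2 \<le> real m / 18}
    \<le> 2 powr ((1 + 7 * real d / 8) * m)"
    (is "real (card ?ball) \<le> _")
proof -
  let ?few = "{xs. set xs \<subseteq> Pow {..<d} \<and> length xs = m \<and> 2 * misses (frame_hit n d T) xs \<le> m}"
  have "finite ?few"
    by (rule finite_subset[OF _ finite_lists_length_eq[of "Pow {..<d}" m]]) auto
  moreover have "?ball \<subseteq> ?few"
  proof safe
    fix xs :: "nat set list"
    assume "(frob_norm n (completed_frame n d xs - T))\<^sup>2 \<le> real (length xs) / 18" "m = length xs"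
    then have "misses (frame_hit n d T) xs / 9 \<le> real (length xs) / 18"
      using misses_frame_hit_le_frob_norm[of xs d n T] assms by simp
    then show "2 * misses (frame_hit n d T) xs \<le> length xs" by linarith
  qed
  ultimately have "card ?ball \<le> card ?few"
    by (rule card_mono)
  also have "real \<dots> \<le> (2 * sqrt (2 powr (3 * real d / 4) * card (Pow {..<d}))) ^ m"
    using assms by (intro card_few_misses_le card_frame_hit_le)
      (auto simp: card_Pow simp flip: powr_realpow)
  also have "\<dots> = 2 powr ((1 + 7 * real d / 8) * m)"
    by (simp add: card_Pow powr_half_sqrt[symmetric] powr_powr powr_mult_base
        flip: powr_realpow powr_add)
  finally show ?thesis by simp
qed

lemma ex_completed_frame_packing:
  assumes "m + d \<le> n" "0 < d"
  shows "\<exists>F. finite F \<and> F \<subseteq> orth_group n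
    \<and> pairwise (\<lambda>A B. real m / 18 < (frob_norm n (A - B))\<^sup>2) F
    \<and> 2 powr ((real d / 8 - 1) * m) \<le> card F"
proof -
  define J where "J = {xs. set xs \<subseteq> Pow {..<d} \<and> length xs = m}"
  define near where "near xs ys \<longleftrightarrow>
    (frob_norm n (completed_frame n d ys - completed_frame n d xs))\<^sup>2 \<le> real m / 18" for xs ys
  have J: "finite J" "card J = 2 ^ (d * m)"
    unfolding J_def
    by (simp_all add: finite_lists_length_eq card_lists_length_eq card_Pow power_mult)
  have near_refl: "near xs xs" for xs
    by (simp add: near_def frob_norm_def L2_set_def)
  have near_sym: "near ys xs" if "near xs ys" for xs ys
    using that by (simp add: near_def frob_norm_minus_commute)
  have "card {ys \<in> J. near xs ys} \<le> 2 powr ((1 + 7 * real d / 8) * m)" for xs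
    using card_completed_frame_ball_le[OF assms] by (simp add: J_def near_def conj_assoc)
  then obtain F where F: "F \<subseteq> J" "pairwise (\<lambda>x y. \<not> near x y) F"
    "card J \<le> 2 powr ((1 + 7 * real d / 8) * m) * card F"
    using ex_separated_subset[of J near, OF J(1) near_refl near_sym] by blast
  have "inj_on (completed_frame n d) F"
  proof (rule inj_onI)
    fix x y assume "x \<in> F" "y \<in> F" "completed_frame n d x = completed_frame n d y"
    moreover from this have "near x y"
      using near_refl[of x] by (simp add: near_def)
    ultimately show "x = y"
      using F(2) by (auto simp: pairwise_def)
  qed
  moreover have "card J = 2 powr ((1 + 7 * real d / 8) * m) * 2 powr ((real d / 8 - 1) * m)"
    by (simp add: J(2) algebra_simps flip: powr_realpow powr_add)
  ultimately have "2 powr ((real d / 8 - 1) * m) \<le> card (completed_frame n d ` F)"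
    using F(3) by (simp add: card_image)
  moreover have "pairwise (\<lambda>A B. real m / 18 < (frob_norm n (A - B))\<^sup>2) (completed_frame n d ` F)"
    using F(2) by (auto simp: pairwise_def near_def not_le frob_norm_minus_commute)
  moreover have "completed_frame n d ` F \<subseteq> orth_group n"
    using F(1) assms by (auto simp: J_def completed_frame_in_orth_group)
  moreover have "finite (completed_frame n d ` F)"
    using finite_subset[OF F(1) J(1)] by simp
  ultimately show ?thesis by blast
qed

lemma orth_group_packing_id_minus_id:
  assumes "1 \<le> r"
  shows "card {id_mat, - id_mat} = 2" "{id_mat, - id_mat} \<subseteq> orth_group r"
    "pairwise (\<lambda>A B. sqrt r / 7 \<le> frob_norm r (A - B)) {id_mat, - id_mat}"
proof -
  have "id_mat (0, 0) \<noteq> (- id_mat) (0, 0)"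
    by (simp add: id_mat_def)
  then have "id_mat \<noteq> - id_mat" by metis
  then show "card {id_mat, - id_mat} = 2" by simp
  show "{id_mat, - id_mat} \<subseteq> orth_group r"
    using id_mat_in_orth_group[of r] by (simp add: orth_group_def orthonormal_cols_def)
  have "(frob_norm r (id_mat - - id_mat))\<^sup>2 = (\<Sum>i<r. \<Sum>j<r. if i = j then 4 else 0)"
    unfolding frob_norm_power2_rows row_norm_def L2_set_power2
    by (intro sum.cong) (auto simp: id_mat_def)
  then have "(sqrt r / 7)\<^sup>2 \<le> (frob_norm r (id_mat - - id_mat))\<^sup>2"
    by (simp add: power_divide)
  then have "sqrt r / 7 \<le> frob_norm r (id_mat - - id_mat)"
    by (rule power2_le_imp_le) (rule frob_norm_nonneg)
  then show "pairwise (\<lambda>A B. sqrt r / 7 \<le> frob_norm r (A - B)) {id_mat, - id_mat}"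
    by (auto simp: pairwise_insert frob_norm_minus_commute[of r "- id_mat"])
qed

text \<open>For \<open>r < 32\<close> the exponent is at most 1, so \<open>I\<close> and \<open>-I\<close> suffice.\<close>

lemma orth_group_packing:
  assumes "1 \<le> r"
  shows "\<exists>F. finite F \<and> F \<subseteq> orth_group r
    \<and> pairwise (\<lambda>A B. sqrt r / 7 \<le> frob_norm r (A - B)) F
    \<and> 2 powr ((real r)\<^sup>2 / 1024) \<le> card F"
proof (cases "r < 32")
  case True
  then have "(real r)\<^sup>2 \<le> 32\<^sup>2"
    by (intro power_mono) auto
  then have "2 powr ((real r)\<^sup>2 / 1024) \<le> 2 powr 1"
    by (intro powr_mono) auto
  then show ?thesis
    using orth_group_packing_id_minus_id[OF assms] by (intro exI[of _ "{id_mat, - id_mat}"]) simp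
next
  case False
  define m d where "m = r div 2" and "d = r - m"
  have bounds: "m + d \<le> r" "0 < d" "18 * real r / 49 \<le> m" "real r / 3 \<le> m" "real r / 2 \<le> d"
    using False unfolding m_def d_def by linarith+
  from ex_completed_frame_packing[OF bounds(1,2)] obtain F where F: "finite F" "F \<subseteq> orth_group r"
    "pairwise (\<lambda>A B. real m / 18 < (frob_norm r (A - B))\<^sup>2) F"
    "2 powr ((real d / 8 - 1) * m) \<le> card F" by blast
  have "sqrt r / 7 \<le> frob_norm r (A - B)" if "real m / 18 < (frob_norm r (A - B))\<^sup>2" for A B
  proof (rule power2_le_imp_le[OF _ frob_norm_nonneg])
    show "(sqrt r / 7)\<^sup>2 \<le> (frob_norm r (A - B))\<^sup>2"
      using that bounds(3) by (simp add: power_divide)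
  qed
  then have "pairwise (\<lambda>A B. sqrt r / 7 \<le> frob_norm r (A - B)) F"
    using F(3) by (auto simp: pairwise_def)
  moreover have "2 powr ((real r)\<^sup>2 / 1024) \<le> card F"
  proof (rule order_trans[OF powr_mono F(4)])
    have "(real r)\<^sup>2 / 1024 \<le> (real r / 32) * (real r / 3)"
      by (simp add: power2_eq_square)
    also have "\<dots> \<le> (real d / 8 - 1) * m"
      using False bounds by (intro mult_mono) auto
    finally show "(real r)\<^sup>2 / 1024 \<le> (real d / 8 - 1) * m" .
  qed simp
  ultimately show ?thesis
    using F(1,2) by blast
qed

section \<open>Stacked orthogonal blocks\<close>

definition stack_mat :: "nat \<Rightarrow> nat \<Rightarrow> (nat \<Rightarrow> mat) \<Rightarrow> mat" where
  "stack_mat r m \<Psi> = (\<lambda>(k, j). if k < m * r then \<Psi> (k div r) (k mod r, j) / sqrt m else 0)"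

lemma block_row_less:
  fixes \<beta> m i r :: nat
  assumes "\<beta> < m" "i < r"
  shows "\<beta> * r + i < m * r"
proof -
  have "\<beta> * r + i < Suc \<beta> * r"
    using assms by simp
  also have "\<dots> \<le> m * r"
    using assms by (intro mult_right_mono) auto
  finally show ?thesis .
qed

lemma stack_mat_block:
  "\<beta> < m \<Longrightarrow> i < r \<Longrightarrow> stack_mat r m \<Psi> (\<beta> * r + i, j) = \<Psi> \<beta> (i, j) / sqrt m"
  by (simp add: stack_mat_def block_row_less)

lemma sum_blocks:
  fixes f :: "nat \<Rightarrow> 'a::comm_monoid_add"
  assumes "m * r \<le> n" "\<And>k. m * r \<le> k \<Longrightarrow> f k = 0"
  shows "(\<Sum>k<n. f k) = (\<Sum>\<beta><m. \<Sum>i<r. f (\<beta> * r + i))"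
proof -
  have "(\<Sum>k<n. f k) = (\<Sum>k<m * r. f k)"
    using assms by (intro sum.mono_neutral_right) auto
  also have "\<dots> = (\<Sum>\<beta><m. sum f {\<beta> * r..<\<beta> * r + r})"
    by (simp only: sum.nat_group)
  also have "\<dots> = (\<Sum>\<beta><m. \<Sum>i<r. f (\<beta> * r + i))"
    by (simp only: sum.atLeastLessThan_shift_0 comp_def add_diff_cancel_left' atLeast0LessThan)
  finally show ?thesis .
qed

lemma orthonormal_cols_stack_mat:
  assumes "0 < m" "m * r \<le> n" and \<Psi>: "\<And>\<beta>. \<beta> < m \<Longrightarrow> \<Psi> \<beta> \<in> orth_group r"
  shows "orthonormal_cols n r (stack_mat r m \<Psi>)"
  unfolding orthonormal_cols_def
proof (intro allI impI)
  fix a c assume ac: "a < r" "c < r"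
  let ?S = "stack_mat r m \<Psi>"
  have "(\<Sum>k<n. ?S (k, a) * ?S (k, c))
      = (\<Sum>\<beta><m. \<Sum>i<r. ?S (\<beta> * r + i, a) * ?S (\<beta> * r + i, c))"
    by (rule sum_blocks[OF assms(2)]) (simp add: stack_mat_def)
  also have "\<dots> = (\<Sum>\<beta><m. (\<Sum>i<r. \<Psi> \<beta> (i, a) * \<Psi> \<beta> (i, c)) / m)"
    by (intro sum.cong refl) (simp add: stack_mat_block sum_divide_distrib)
  also have "\<dots> = (\<Sum>\<beta><m. (if a = c then 1 else 0) / m)"
    using \<Psi> ac by (intro sum.cong) (simp_all add: orth_group_def orthonormal_colsD[where r=r])
  also have "\<dots> = (if a = c then 1 else 0)"
    using assms(1) by simp
  finally show "(\<Sum>k<n. ?S (k, a) * ?S (k, c)) = (if a = c then 1 else 0)" .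
qed

lemma row_norm_stack_mat_le:
  assumes \<Psi>: "\<And>\<beta>. \<beta> < m \<Longrightarrow> \<Psi> \<beta> \<in> orth_group r"
  shows "row_norm r (stack_mat r m \<Psi>) k \<le> 1 / sqrt m"
proof (cases "k < m * r")
  case True
  then have k: "k div r < m" "k mod r < r"
    by (auto simp: less_mult_imp_div_less intro!: mod_less_divisor gr0I)
  have "row_norm r (stack_mat r m \<Psi>) k = row_norm r (\<Psi> (k div r)) (k mod r) * (1 / sqrt m)"
    using True unfolding row_norm_def by (subst L2_set_left_distrib) (simp_all add: stack_mat_def)
  then show ?thesis
    using k \<Psi> by (simp add: row_norm_orth_group)
qed (simp add: row_norm_def stack_mat_def L2_set_def)

lemma stack_mat_in_K_set:
  assumes "0 < m" "0 < n" "m * r \<le> n" and \<Psi>: "\<And>\<beta>. \<beta> < m \<Longrightarrow> \<Psi> \<beta> \<in> orth_group r"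
    and \<mu>: "1 / m \<le> r * \<mu> / n"
  shows "stack_mat r m \<Psi> \<in> K_set n r \<mu>"
proof -
  have "row_norm r (stack_mat r m \<Psi>) k \<le> sqrt (r * \<mu> / n)" for k
    using row_norm_stack_mat_le[of m \<Psi> r k] real_sqrt_le_mono[OF \<mu>] \<Psi>
    by (simp add: real_sqrt_divide)
  then show ?thesis
    using orthonormal_cols_stack_mat[OF assms(1,3) \<Psi>] \<open>0 < n\<close>
    by (simp add: K_set_def norm_2inf_le_iff)
qed

lemma frob_norm_block_le_norm_2inf:
  assumes "0 < n" "m * r \<le> n" "\<beta> < m"
  shows "frob_norm r (\<Phi> \<beta> - mat_mult r (\<Psi> \<beta>) Q)
    \<le> sqrt r * (sqrt m * norm_2inf n r (stack_mat r m \<Phi> - mat_mult r (stack_mat r m \<Psi>) Q))"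
    (is "_ \<le> _ * (_ * ?D)")
proof (rule frob_norm_le_rows)
  fix i assume "i < r"
  let ?S = "stack_mat r m \<Phi> - mat_mult r (stack_mat r m \<Psi>) Q"
  have S: "(\<Phi> \<beta> - mat_mult r (\<Psi> \<beta>) Q) (i, j) = sqrt m * ?S (\<beta> * r + i, j)" for j
    using \<open>\<beta> < m\<close> \<open>i < r\<close>
    by (simp add: mat_mult_def stack_mat_block right_diff_distrib flip: sum_divide_distrib)
  have "row_norm r (\<Phi> \<beta> - mat_mult r (\<Psi> \<beta>) Q) i = sqrt m * row_norm r ?S (\<beta> * r + i)"
    unfolding row_norm_def S by (rule L2_set_right_distrib[symmetric]) simp
  also have "\<dots> \<le> sqrt m * ?D"
    using norm_2inf_le_iff[OF assms(1), of r ?S ?D] block_row_less[OF \<open>\<beta> < m\<close> \<open>i < r\<close>] assms(2)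
    by (intro mult_left_mono) auto
  finally show "row_norm r (\<Phi> \<beta> - mat_mult r (\<Psi> \<beta>) Q) i \<le> sqrt m * ?D" .
qed (simp add: norm_2inf_nonneg[OF assms(1)])

lemma frob_norm_mat_mult_diff_self:
  assumes "A \<in> orth_group r"
  shows "frob_norm r (mat_mult r A Q - A) = frob_norm r (Q - id_mat)"
proof -
  have "frob_norm r (mat_mult r A Q - A) = frob_norm r (mat_mult r A (Q - id_mat))"
    unfolding mat_mult_diff_right frob_norm_def by (intro L2_set_cong)
      (auto simp: mat_mult_id_right)
  then show ?thesis
    by (simp add: frob_norm_mat_mult[OF assms])
qed

text \<open>The common block \<open>0\<close> forces the aligning rotation to be close to the identity.\<close>

lemma frob_norm_block_le_d_2inf:
  assumes "1 \<le> r" "0 < m" "m * r \<le> n" "\<beta> < m"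
    and \<Psi>: "\<Psi> 0 \<in> orth_group r" "\<Psi> \<beta> \<in> orth_group r" and eq: "\<Phi> 0 = \<Psi> 0"
  shows "frob_norm r (\<Phi> \<beta> - \<Psi> \<beta>) / (2 * sqrt (r * m))
    \<le> d_2inf n r (stack_mat r m \<Psi>) (stack_mat r m \<Phi>)"
proof (rule d_2inf_greatest)
  fix Q assume "Q \<in> orth_group r"
  let ?D = "norm_2inf n r (stack_mat r m \<Phi> - mat_mult r (stack_mat r m \<Psi>) Q)"
  have "0 < m * r" using assms(1,2) by simp
  then have "0 < n" using assms(3) by linarith
  have decomp: "\<Phi> \<beta> - \<Psi> \<beta>
      = (\<Phi> \<beta> - mat_mult r (\<Psi> \<beta>) Q) - (\<Psi> \<beta> - mat_mult r (\<Psi> \<beta>) Q)"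
    by (simp add: fun_eq_iff)
  have "frob_norm r (\<Phi> \<beta> - \<Psi> \<beta>)
      \<le> frob_norm r (\<Phi> \<beta> - mat_mult r (\<Psi> \<beta>) Q) + frob_norm r (\<Psi> \<beta> - mat_mult r (\<Psi> \<beta>) Q)"
    by (subst decomp) (rule frob_norm_diff_le)
  also have "\<dots>
      = frob_norm r (\<Phi> \<beta> - mat_mult r (\<Psi> \<beta>) Q) + frob_norm r (\<Phi> 0 - mat_mult r (\<Psi> 0) Q)"
    unfolding eq using \<Psi>
    by (simp add: frob_norm_minus_commute[of r "\<Psi> _"] frob_norm_mat_mult_diff_self)
  also have "\<dots> \<le> sqrt r * (sqrt m * ?D) + sqrt r * (sqrt m * ?D)"
    using \<open>0 < n\<close> assms(2-4) by (intro add_mono frob_norm_block_le_norm_2inf)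
  finally show "frob_norm r (\<Phi> \<beta> - \<Psi> \<beta>) / (2 * sqrt (r * m)) \<le> ?D"
    using assms(1,2) by (simp add: field_simps real_sqrt_mult)
qed

definition block_choices :: "nat \<Rightarrow> mat set \<Rightarrow> (nat \<Rightarrow> mat) set" where
  "block_choices b F = (\<Pi>\<^sub>E \<beta>\<in>{..<Suc b}. if \<beta> = 0 then {id_mat} else F)"

lemma block_choicesD:
  "\<Psi> \<in> block_choices b F \<Longrightarrow> \<beta> < Suc b \<Longrightarrow> \<Psi> \<beta> \<in> (if \<beta> = 0 then {id_mat} else F)"
  using PiE_mem[of \<Psi> "{..<Suc b}" "\<lambda>\<beta>. if \<beta> = 0 then {id_mat} else F" \<beta>]
  by (simp add: block_choices_def)

lemma block_choices_first: "\<Psi> \<in> block_choices b F \<Longrightarrow> \<Psi> 0 = id_mat"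
  using block_choicesD[of \<Psi> b F 0] by simp

lemma block_choices_in_orth_group:
  assumes "F \<subseteq> orth_group r" "\<Psi> \<in> block_choices b F" "\<beta> < Suc b"
  shows "\<Psi> \<beta> \<in> orth_group r"
  using block_choicesD[OF assms(2,3)] assms(1) id_mat_in_orth_group by (auto split: if_splits)

lemma finite_block_choices: "finite F \<Longrightarrow> finite (block_choices b F)"
  unfolding block_choices_def by (intro finite_PiE) auto

lemma card_block_choices: "card (block_choices b F) = card F ^ b"
  unfolding block_choices_def
  by (subst card_PiE) (simp_all add: prod.lessThan_Suc_shift del: prod.lessThan_Suc)

lemma d_2inf_stack_mat_ge:
  assumes "1 \<le> r" "Suc b * r \<le> n" and F: "F \<subseteq> orth_group r"
    and sep: "pairwise (\<lambda>A B. c \<le> frob_norm r (A - B)) F"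
    and \<Psi>: "\<Psi> \<in> block_choices b F" and \<Phi>: "\<Phi> \<in> block_choices b F" and "\<Psi> \<noteq> \<Phi>"
  shows "c / (2 * sqrt (r * Suc b)) \<le> d_2inf n r (stack_mat r (Suc b) \<Psi>) (stack_mat r (Suc b) \<Phi>)"
proof -
  obtain \<beta> where \<beta>: "\<beta> < Suc b" "\<Psi> \<beta> \<noteq> \<Phi> \<beta>"
    using PiE_ext[OF \<Psi>[unfolded block_choices_def] \<Phi>[unfolded block_choices_def]] \<open>\<Psi> \<noteq> \<Phi>\<close> by blast
  then have "\<Psi> \<beta> \<in> F" "\<Phi> \<beta> \<in> F"
    using block_choicesD[OF \<Psi> \<beta>(1)] block_choicesD[OF \<Phi> \<beta>(1)] by (auto split: if_splits)
  then have "c \<le> frob_norm r (\<Phi> \<beta> - \<Psi> \<beta>)"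
    using pairwiseD[OF sep] \<beta>(2) by metis
  then have "c / (2 * sqrt (r * Suc b)) \<le> frob_norm r (\<Phi> \<beta> - \<Psi> \<beta>) / (2 * sqrt (r * Suc b))"
    by (intro divide_right_mono) auto
  also have "\<dots> \<le> d_2inf n r (stack_mat r (Suc b) \<Psi>) (stack_mat r (Suc b) \<Phi>)"
    using assms(1,2) \<beta>(1) block_choices_first[OF \<Psi>] block_choices_first[OF \<Phi>]
      block_choices_in_orth_group[OF F \<Psi>] id_mat_in_orth_group
    by (intro frob_norm_block_le_d_2inf) auto
  finally show ?thesis .
qed

lemma K_set_packing:
  assumes "1 \<le> r" "Suc b * r \<le> n" "1 / Suc b \<le> r * \<mu> / n"
  shows "\<exists>F. finite F \<and> F \<subseteq> K_set n r \<mu>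
    \<and> pairwise (\<lambda>U V. 1 / (14 * sqrt (Suc b)) \<le> d_2inf n r U V) F
    \<and> 2 powr (b * (real r)\<^sup>2 / 1024) \<le> card F"
proof -
  obtain F where F: "finite F" "F \<subseteq> orth_group r"
    "pairwise (\<lambda>A B. sqrt r / 7 \<le> frob_norm r (A - B)) F" "2 powr ((real r)\<^sup>2 / 1024) \<le> card F"
    using orth_group_packing[OF \<open>1 \<le> r\<close>] by blast
  define S where "S = stack_mat r (Suc b) ` block_choices b F"
  have "0 < Suc b * r" using \<open>1 \<le> r\<close> by simp
  then have "0 < n" using assms(2) by linarith
  have "sqrt r / 7 / (2 * sqrt (r * Suc b)) = 1 / (14 * sqrt (Suc b))"
    unfolding of_nat_mult real_sqrt_mult using \<open>1 \<le> r\<close> by simp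
  then have sep: "1 / (14 * sqrt (Suc b))
      \<le> d_2inf n r (stack_mat r (Suc b) \<Psi>) (stack_mat r (Suc b) \<Phi>)"
    if "\<Psi> \<in> block_choices b F" "\<Phi> \<in> block_choices b F" "\<Psi> \<noteq> \<Phi>" for \<Psi> \<Phi>
    using d_2inf_stack_mat_ge[OF assms(1,2) F(2,3) that] by simp
  have "d_2inf n r U U < 1 / (14 * sqrt (Suc b))" for U
    using \<open>0 < n\<close> by (intro d_2inf_self_less) simp_all
  then have "inj_on (stack_mat r (Suc b)) (block_choices b F)"
    using sep by (intro inj_onI) (metis not_le)
  then have "real (card S) = real (card F) ^ b"
    by (simp add: S_def card_image card_block_choices)
  moreover have "2 powr (b * (real r)\<^sup>2 / 1024) = (2 powr ((real r)\<^sup>2 / 1024)) ^ b"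
    by (simp add: powr_powr mult.commute flip: powr_realpow)
  ultimately have "2 powr (b * (real r)\<^sup>2 / 1024) \<le> card S"
    using F(4) by (simp add: power_mono)
  moreover have "S \<subseteq> K_set n r \<mu>"
    using assms(2,3) \<open>0 < n\<close> block_choices_in_orth_group[OF F(2)]
    unfolding S_def by (intro image_subsetI stack_mat_in_K_set) auto
  moreover have "finite S"
    unfolding S_def using F(1) by (intro finite_imageI finite_block_choices)
  moreover have "pairwise (\<lambda>U V. 1 / (14 * sqrt (Suc b)) \<le> d_2inf n r U V) S"
    using sep by (auto simp: pairwise_def S_def)
  ultimately show ?thesis by blast
qed

section \<open>Gaussian shifts\<close>

lemma (in product_sigma_finite) PiM_density:
  assumes "finite I" and f[measurable]: "\<And>i. f i \<in> borel_measurable (M i)"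
    and density: "\<And>i. sigma_finite_measure (density (M i) (f i))"
  shows "PiM I (\<lambda>i. density (M i) (f i)) = density (PiM I M) (\<lambda>x. \<Prod>i\<in>I. f i (x i))"
proof -
  interpret D: product_sigma_finite "\<lambda>i. density (M i) (f i)"
    by (rule product_sigma_finite.intro) (rule density)
  show ?thesis
  proof (rule D.PiM_eqI[symmetric])
    fix A assume "\<And>i. i \<in> I \<Longrightarrow> A i \<in> sets (density (M i) (f i))"
    then have A: "\<And>i. i \<in> I \<Longrightarrow> A i \<in> sets (M i)" by simp
    have "emeasure (density (PiM I M) (\<lambda>x. \<Prod>i\<in>I. f i (x i))) (Pi\<^sub>E I A)
        = (\<integral>\<^sup>+ x. (\<Prod>i\<in>I. f i (x i)) * indicator (Pi\<^sub>E I A) x \<partial>PiM I M)"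
      by (rule emeasure_density) (use A \<open>finite I\<close> in \<open>auto intro!: sets_PiM_I_finite\<close>)
    also have "\<dots> = (\<integral>\<^sup>+ x. (\<Prod>i\<in>I. f i (x i) * indicator (A i) (x i)) \<partial>PiM I M)"
    proof (rule nn_integral_cong)
      fix x assume "x \<in> space (PiM I M)"
      then have "indicator (Pi\<^sub>E I A) x = (\<Prod>i\<in>I. indicator (A i) (x i) :: ennreal)"
        using \<open>finite I\<close> by (auto simp: space_PiM PiE_iff indicator_def prod_zero_iff)
      then show "(\<Prod>i\<in>I. f i (x i)) * indicator (Pi\<^sub>E I A) x
          = (\<Prod>i\<in>I. f i (x i) * indicator (A i) (x i))"
        by (simp add: prod.distrib)
    qed
    also have "\<dots> = (\<Prod>i\<in>I. \<integral>\<^sup>+ x. f i x * indicator (A i) x \<partial>M i)"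
      using A \<open>finite I\<close> by (intro product_nn_integral_prod) auto
    also have "\<dots> = (\<Prod>i\<in>I. emeasure (density (M i) (f i)) (A i))"
      using A by (intro prod.cong refl emeasure_density[symmetric]) auto
    finally show "emeasure (density (PiM I M) (\<lambda>x. \<Prod>i\<in>I. f i (x i))) (Pi\<^sub>E I A)
        = (\<Prod>i\<in>I. emeasure (density (M i) (f i)) (A i))" .
  qed (use \<open>finite I\<close> in \<open>auto intro!: sets_PiM_cong\<close>)
qed

lemma (in product_sigma_finite) distr_PiM_componentwise:
  assumes "finite I" and f[measurable]: "\<And>i. f i \<in> M i \<rightarrow>\<^sub>M N i"
    and distr: "\<And>i. sigma_finite_measure (distr (M i) (N i) (f i))"
  shows "distr (PiM I M) (PiM I N) (\<lambda>x. \<lambda>i\<in>I. f i (x i)) = PiM I (\<lambda>i. distr (M i) (N i) (f i))"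
proof -
  interpret D: product_sigma_finite "\<lambda>i. distr (M i) (N i) (f i)"
    by (rule product_sigma_finite.intro) (rule distr)
  show ?thesis
  proof (rule D.PiM_eqI)
    fix A assume "\<And>i. i \<in> I \<Longrightarrow> A i \<in> sets (distr (M i) (N i) (f i))"
    then have A: "\<And>i. i \<in> I \<Longrightarrow> A i \<in> sets (N i)" by simp
    have vimage: "(\<lambda>x. \<lambda>i\<in>I. f i (x i)) -` Pi\<^sub>E I A \<inter> space (PiM I M)
        = Pi\<^sub>E I (\<lambda>i. f i -` A i \<inter> space (M i))"
      by (auto simp: space_PiM PiE_iff extensional_def)
    have "emeasure (distr (PiM I M) (PiM I N) (\<lambda>x. \<lambda>i\<in>I. f i (x i))) (Pi\<^sub>E I A)
        = emeasure (PiM I M) (Pi\<^sub>E I (\<lambda>i. f i -` A i \<inter> space (M i)))"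
      by (subst emeasure_distr) (use A \<open>finite I\<close> vimage in \<open>auto intro!: sets_PiM_I_finite\<close>)
    also have "\<dots> = (\<Prod>i\<in>I. emeasure (M i) (f i -` A i \<inter> space (M i)))"
      using A \<open>finite I\<close> by (intro emeasure_PiM) auto
    also have "\<dots> = (\<Prod>i\<in>I. emeasure (distr (M i) (N i) (f i)) (A i))"
      using A by (intro prod.cong refl emeasure_distr[symmetric]) auto
    finally show "emeasure (distr (PiM I M) (PiM I N) (\<lambda>x. \<lambda>i\<in>I. f i (x i))) (Pi\<^sub>E I A)
        = (\<Prod>i\<in>I. emeasure (distr (M i) (N i) (f i)) (A i))" .
  qed (use \<open>finite I\<close> in \<open>auto intro!: sets_PiM_cong\<close>)
qed

lemma emeasure_density_power2_le:
  assumes [measurable]: "f \<in> borel_measurable M" "A \<in> sets M"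
  shows "(emeasure (density M f) A)\<^sup>2 \<le> (\<integral>\<^sup>+ x. (f x)\<^sup>2 \<partial>M) * emeasure M A"
proof -
  have "(emeasure (density M f) A)\<^sup>2 = (\<integral>\<^sup>+ x. f x * indicator A x \<partial>M)\<^sup>2"
    by (simp add: emeasure_density)
  also have "\<dots> \<le> (\<integral>\<^sup>+ x. (f x)\<^sup>2 \<partial>M) * (\<integral>\<^sup>+ x. (indicator A x)\<^sup>2 \<partial>M)"
    by (rule Cauchy_Schwarz_nn_integral) measurable
  also have "(\<integral>\<^sup>+ x. (indicator A x :: ennreal)\<^sup>2 \<partial>M) = (\<integral>\<^sup>+ x. indicator A x \<partial>M)"
    by (intro nn_integral_cong) (simp add: indicator_def)
  finally show ?thesis by simp
qed

abbreviation centered_normal :: "real \<Rightarrow> real measure" where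
  "centered_normal \<sigma> \<equiv> density lborel (normal_density 0 \<sigma>)"

definition normal_likelihood_ratio :: "real \<Rightarrow> real \<Rightarrow> real \<Rightarrow> real" where
  "normal_likelihood_ratio \<sigma> s x = exp ((2 * s * x - s\<^sup>2) / (2 * \<sigma>\<^sup>2))"

lemma normal_likelihood_ratio_pos: "0 < normal_likelihood_ratio \<sigma> s x"
  by (simp add: normal_likelihood_ratio_def)

lemma borel_measurable_normal_likelihood_ratio[measurable]:
  "normal_likelihood_ratio \<sigma> s \<in> borel_measurable borel"
  unfolding normal_likelihood_ratio_def[abs_def] by measurable

lemma normal_density_eq_likelihood_ratio:
  "normal_density s \<sigma> x = normal_density 0 \<sigma> x * normal_likelihood_ratio \<sigma> s x"
proof -
  have "- (x - s)\<^sup>2 / (2 * \<sigma>\<^sup>2) = - x\<^sup>2 / (2 * \<sigma>\<^sup>2) + (2 * s * x - s\<^sup>2) / (2 * \<sigma>\<^sup>2)"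
    by (simp add: add_divide_distrib[symmetric] power2_eq_square algebra_simps)
  then show ?thesis
    by (simp only: normal_density_def normal_likelihood_ratio_def exp_add diff_zero mult.assoc)
qed

lemma density_normal_likelihood_ratio:
  "density (centered_normal \<sigma>) (normal_likelihood_ratio \<sigma> s) = density lborel (normal_density s \<sigma>)"
  by (subst density_density_eq) (auto simp: normal_density_eq_likelihood_ratio[of s] ennreal_mult'
      less_imp_le[OF normal_likelihood_ratio_pos])

lemma distr_centered_normal_shift:
  assumes "0 < \<sigma>"
  shows "distr (centered_normal \<sigma>) (centered_normal \<sigma>) (\<lambda>x. x + s)
    = density (centered_normal \<sigma>) (normal_likelihood_ratio \<sigma> s)"
proof -
  interpret N: prob_space "centered_normal \<sigma>"
    using assms by (rule prob_space_normal_density)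
  have "distributed (centered_normal \<sigma>) lborel (\<lambda>x. x) (normal_density 0 \<sigma>)"
    by (simp add: distributed_def distr_id2)
  from N.normal_density_affine[OF this assms, of 1 s]
  have "distr (centered_normal \<sigma>) lborel (\<lambda>x. s + x) = density lborel (normal_density s \<sigma>)"
    by (simp add: distributed_def)
  moreover have "distr (centered_normal \<sigma>) (centered_normal \<sigma>) (\<lambda>x. x + s)
      = distr (centered_normal \<sigma>) lborel (\<lambda>x. s + x)"
    by (rule distr_cong) (simp_all add: add.commute)
  ultimately show ?thesis
    by (simp only: density_normal_likelihood_ratio)
qed

lemma nn_integral_normal_likelihood_ratio_power2:
  assumes "0 < \<sigma>"
  shows "(\<integral>\<^sup>+ x. (ennreal (normal_likelihood_ratio \<sigma> s x))\<^sup>2 \<partial>centered_normal \<sigma>)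
    = ennreal (exp (s\<^sup>2 / \<sigma>\<^sup>2))"
proof -
  interpret P: prob_space "density (centered_normal \<sigma>) (normal_likelihood_ratio \<sigma> (2 * s))"
    unfolding density_normal_likelihood_ratio using assms by (rule prob_space_normal_density)
  have "(normal_likelihood_ratio \<sigma> s x)\<^sup>2 = exp (s\<^sup>2 / \<sigma>\<^sup>2) * normal_likelihood_ratio \<sigma> (2 * s) x" for x
  proof -
    have "2 * ((2 * s * x - s\<^sup>2) / (2 * \<sigma>\<^sup>2)) = s\<^sup>2 / \<sigma>\<^sup>2 + (2 * (2 * s) * x - (2 * s)\<^sup>2) / (2 * \<sigma>\<^sup>2)"
      using assms by (simp add: field_simps power2_eq_square)
    then show ?thesis
      by (simp only: normal_likelihood_ratio_def exp_add[symmetric] exp_double[symmetric])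
  qed
  then have "(\<integral>\<^sup>+ x. (ennreal (normal_likelihood_ratio \<sigma> s x))\<^sup>2 \<partial>centered_normal \<sigma>)
      = (\<integral>\<^sup>+ x. ennreal (exp (s\<^sup>2 / \<sigma>\<^sup>2)) * ennreal (normal_likelihood_ratio \<sigma> (2 * s) x)
          \<partial>centered_normal \<sigma>)"
    by (simp add: ennreal_power ennreal_mult' less_imp_le[OF normal_likelihood_ratio_pos])
  also have "\<dots> = ennreal (exp (s\<^sup>2 / \<sigma>\<^sup>2))
      * emeasure (density (centered_normal \<sigma>) (normal_likelihood_ratio \<sigma> (2 * s))) UNIV"
    by (subst nn_integral_cmult) (simp_all add: emeasure_density)
  also have "\<dots> = ennreal (exp (s\<^sup>2 / \<sigma>\<^sup>2))"
    using P.emeasure_space_1 by simp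
  finally show ?thesis .
qed

lemma emeasure_PiM_normal_shift_power2_le:
  fixes s :: "'i \<Rightarrow> real"
  assumes "finite I" "0 < \<sigma>"
  defines "Q \<equiv> PiM I (\<lambda>_. centered_normal \<sigma>)"
  assumes B: "B \<in> sets Q"
  shows "(emeasure (distr Q Q (\<lambda>w. \<lambda>i\<in>I. w i + s i)) B)\<^sup>2
    \<le> ennreal (exp ((\<Sum>i\<in>I. (s i)\<^sup>2) / \<sigma>\<^sup>2)) * emeasure Q B"
proof -
  let ?L = "\<lambda>w. \<Prod>i\<in>I. ennreal (normal_likelihood_ratio \<sigma> (s i) (w i))"
  have normal: "prob_space (centered_normal \<sigma>)"
    "prob_space (density lborel (normal_density (s i) \<sigma>))" for i
    using \<open>0 < \<sigma>\<close> by (rule prob_space_normal_density)+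
  interpret product_prob_space "\<lambda>_::'i. centered_normal \<sigma>"
    by (rule product_prob_spaceI) (rule normal)
  have sigma_finite:
    "sigma_finite_measure (density (centered_normal \<sigma>) (normal_likelihood_ratio \<sigma> (s i)))" for i
    unfolding density_normal_likelihood_ratio using normal(2) by (rule prob_space_imp_sigma_finite)
  have "distr Q Q (\<lambda>w. \<lambda>i\<in>I. w i + s i)
      = PiM I (\<lambda>i. distr (centered_normal \<sigma>) (centered_normal \<sigma>) (\<lambda>x. x + s i))"
    unfolding Q_def using \<open>0 < \<sigma>\<close> sigma_finite
    by (intro distr_PiM_componentwise[OF \<open>finite I\<close>]) (auto simp: distr_centered_normal_shift)
  also have "\<dots> = density Q ?L"
    unfolding Q_def distr_centered_normal_shift[OF \<open>0 < \<sigma>\<close>] using sigma_finite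
    by (intro PiM_density[OF \<open>finite I\<close>]) auto
  finally have "(emeasure (distr Q Q (\<lambda>w. \<lambda>i\<in>I. w i + s i)) B)\<^sup>2
      \<le> (\<integral>\<^sup>+ w. (?L w)\<^sup>2 \<partial>Q) * emeasure Q B"
    using B by (simp only:) (intro emeasure_density_power2_le, auto simp: Q_def)
  also have "(\<integral>\<^sup>+ w. (?L w)\<^sup>2 \<partial>Q)
      = (\<Prod>i\<in>I. \<integral>\<^sup>+ x. (ennreal (normal_likelihood_ratio \<sigma> (s i) x))\<^sup>2 \<partial>centered_normal \<sigma>)"
    unfolding Q_def prod_power_distrib by (rule product_nn_integral_prod) (auto simp: \<open>finite I\<close>)
  also have "\<dots> = ennreal (exp ((\<Sum>i\<in>I. (s i)\<^sup>2) / \<sigma>\<^sup>2))"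
    by (simp add: nn_integral_normal_likelihood_ratio_power2[OF \<open>0 < \<sigma>\<close>] prod_ennreal
        exp_sum[OF \<open>finite I\<close>] sum_divide_distrib)
  finally show ?thesis .
qed

section \<open>Reduction to testing\<close>

lemma ex_measure_le_half:
  assumes "prob_space Q" "finite J" "J \<noteq> {}"
    and A: "\<And>j. j \<in> J \<Longrightarrow> A j \<in> sets Q" "disjoint_family_on A J"
    and P: "\<And>j. j \<in> J \<Longrightarrow> (measure (P j) (A j))\<^sup>2 \<le> K * measure Q (A j)"
    and "0 \<le> K" "4 * K \<le> card J"
  shows "\<exists>j\<in>J. measure (P j) (A j) \<le> 1/2"
proof (rule ccontr)
  interpret prob_space Q by fact
  assume "\<not> ?thesis"
  then have large: "1/2 < measure (P j) (A j)" if "j \<in> J" for j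
    using that by (auto simp: not_le)
  have "card J / 4 = (\<Sum>j\<in>J. (1/2)\<^sup>2)"
    by (simp add: power2_eq_square)
  also have "\<dots> < (\<Sum>j\<in>J. (measure (P j) (A j))\<^sup>2)"
    using \<open>finite J\<close> \<open>J \<noteq> {}\<close> large by (intro sum_strict_mono power_strict_mono) auto
  also have "\<dots> \<le> K * (\<Sum>j\<in>J. measure Q (A j))"
    unfolding sum_distrib_left by (intro sum_mono P)
  also have "(\<Sum>j\<in>J. measure Q (A j)) = measure Q (\<Union>j\<in>J. A j)"
    using \<open>finite J\<close> A by (intro finite_measure_finite_Union[symmetric]) auto
  also have "K * \<dots> \<le> K"
    using \<open>0 \<le> K\<close> by (simp add: mult_left_le)
  finally show False
    using \<open>4 * K \<le> card J\<close> by simp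
qed

definition upper_triangle :: "nat \<Rightarrow> (nat \<times> nat) set" where
  "upper_triangle n = {(i, j). i \<le> j \<and> j < n}"

lemma upper_triangle_subset: "upper_triangle n \<subseteq> {..<n} \<times> {..<n}"
  by (auto simp: upper_triangle_def)

lemma finite_upper_triangle: "finite (upper_triangle n)"
  using upper_triangle_subset by (rule finite_subset) simp

lemma noise_space_eq: "noise_space n \<sigma> = PiM (upper_triangle n) (\<lambda>_. centered_normal \<sigma>)"
  by (simp add: noise_space_def upper_triangle_def)

lemma prob_space_noise_space: "0 < \<sigma> \<Longrightarrow> prob_space (noise_space n \<sigma>)"
  unfolding noise_space_def by (intro prob_space_PiM prob_space_normal_density)

lemma measurable_observe[measurable]: "observe n M \<in> noise_space n \<sigma> \<rightarrow>\<^sub>M obs_space n"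
  unfolding observe_def obs_space_def
proof (rule measurable_restrict)
  fix p assume "p \<in> {..<n} \<times> {..<n}"
  then have "(min (fst p) (snd p), max (fst p) (snd p)) \<in> upper_triangle n"
    by (auto simp: upper_triangle_def)
  then have [measurable]:
    "(\<lambda>w. w (min (fst p) (snd p), max (fst p) (snd p))) \<in> borel_measurable (noise_space n \<sigma>)"
    unfolding noise_space_eq
    by (auto dest: measurable_component_singleton[where M="\<lambda>_. centered_normal \<sigma>"])
  show "(\<lambda>w. case p of (i, j) \<Rightarrow> M (i, j) + w (min i j, max i j))
      \<in> borel_measurable (noise_space n \<sigma>)"
    unfolding case_prod_beta by measurable
qed

lemma observe_symmetric_eq_shift:
  assumes "\<And>i j. M (i, j) = M (j, i)"
  shows "observe n M w = observe n (\<lambda>_. 0) (\<lambda>p\<in>upper_triangle n. w p + M p)"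
proof -
  have "M (i, j) = M (min i j, max i j)" for i j
    using assms by (simp add: min_def max_def)
  then show ?thesis
    by (auto simp: observe_def upper_triangle_def fun_eq_iff)
qed

definition obs_law :: "nat \<Rightarrow> real \<Rightarrow> mat \<Rightarrow> mat measure" where
  "obs_law n \<sigma> M = distr (noise_space n \<sigma>) (obs_space n) (observe n M)"

lemma sets_obs_law[measurable_cong, simp]: "sets (obs_law n \<sigma> M) = sets (obs_space n)"
  by (simp add: obs_law_def)

lemma space_obs_law[simp]: "space (obs_law n \<sigma> M) = space (obs_space n)"
  by (simp add: obs_law_def)

lemma prob_space_obs_law: "0 < \<sigma> \<Longrightarrow> prob_space (obs_law n \<sigma> M)"
  unfolding obs_law_def
  by (intro prob_space.prob_space_distr prob_space_noise_space measurable_observe)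

lemma measure_obs_law_power2_le:
  assumes "0 < \<sigma>" and sym: "\<And>i j. M (i, j) = M (j, i)" and B: "B \<in> sets (obs_space n)"
  shows "(measure (obs_law n \<sigma> M) B)\<^sup>2
    \<le> exp ((\<Sum>p\<in>upper_triangle n. (M p)\<^sup>2) / \<sigma>\<^sup>2) * measure (obs_law n \<sigma> (\<lambda>_. 0)) B"
proof -
  let ?Q = "noise_space n \<sigma>" and ?E = "exp ((\<Sum>p\<in>upper_triangle n. (M p)\<^sup>2) / \<sigma>\<^sup>2)"
  let ?B = "observe n (\<lambda>_. 0) -` B \<inter> space ?Q"
  interpret P: prob_space "obs_law n \<sigma> M" using \<open>0 < \<sigma>\<close> by (rule prob_space_obs_law)
  interpret P0: prob_space "obs_law n \<sigma> (\<lambda>_. 0)" using \<open>0 < \<sigma>\<close> by (rule prob_space_obs_law)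
  have shift: "(\<lambda>w. \<lambda>p\<in>upper_triangle n. w p + M p) \<in> ?Q \<rightarrow>\<^sub>M ?Q"
    unfolding noise_space_eq by measurable
  have "observe n M = observe n (\<lambda>_. 0) \<circ> (\<lambda>w. \<lambda>p\<in>upper_triangle n. w p + M p)"
    using observe_symmetric_eq_shift[of M, OF sym] by (simp add: fun_eq_iff)
  then have "obs_law n \<sigma> M = distr (distr ?Q ?Q (\<lambda>w. \<lambda>p\<in>upper_triangle n. w p + M p))
      (obs_space n) (observe n (\<lambda>_. 0))"
    using shift by (simp add: obs_law_def distr_distr)
  then have "emeasure (obs_law n \<sigma> M) B
      = emeasure (distr ?Q ?Q (\<lambda>w. \<lambda>p\<in>upper_triangle n. w p + M p)) ?B"
    using B by (simp add: emeasure_distr)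
  then have "(emeasure (obs_law n \<sigma> M) B)\<^sup>2 \<le> ennreal ?E * emeasure ?Q ?B"
    using emeasure_PiM_normal_shift_power2_le[OF finite_upper_triangle \<open>0 < \<sigma>\<close>, of ?B n M]
      measurable_sets[OF measurable_observe B] by (simp add: noise_space_eq)
  also have "emeasure ?Q ?B = emeasure (obs_law n \<sigma> (\<lambda>_. 0)) B"
    using B by (simp add: obs_law_def emeasure_distr)
  finally show ?thesis
    by (simp add: P.emeasure_eq_measure P0.emeasure_eq_measure ennreal_power
        ennreal_mult'[symmetric])
qed

lemma sum_signal_power2_le:
  assumes U: "orthonormal_cols n r U"
  shows "(\<Sum>p\<in>upper_triangle n. (signal r lam U p)\<^sup>2) \<le> lam\<^sup>2 * r"
proof -
  have "(\<Sum>p\<in>upper_triangle n. (signal r lam U p)\<^sup>2) \<le> (\<Sum>p\<in>{..<n} \<times> {..<n}. (signal r lam U p)\<^sup>2)"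
    by (rule sum_mono2[OF _ upper_triangle_subset]) auto
  also have "\<dots> = (\<Sum>j<n. \<Sum>i<n. (signal r lam U (j, i))\<^sup>2)"
    by (simp add: sum.cartesian_product)
  also have "\<dots> = (\<Sum>j<n. lam\<^sup>2 * (L2_set (\<lambda>i. \<Sum>k<r. U (i, k) * U (j, k)) {..<n})\<^sup>2)"
    by (simp add: signal_def L2_set_power2 power_mult_distrib mult.commute flip: sum_distrib_left)
  also have "\<dots> = lam\<^sup>2 * (\<Sum>j<n. \<Sum>k<r. (U (j, k))\<^sup>2)"
    by (simp only: L2_set_orthonormal_cols[OF U] L2_set_power2 sum_distrib_left)
  also have "\<dots> = lam\<^sup>2 * r"
    by (simp only: sum_power2_orthonormal_cols[OF U])
  finally show ?thesis .
qed

lemma measure_obs_law_signal_power2_le: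
  assumes "0 < \<sigma>" "orthonormal_cols n r U" "B \<in> sets (obs_space n)"
  shows "(measure (obs_law n \<sigma> (signal r lam U)) B)\<^sup>2
    \<le> exp (lam\<^sup>2 * r / \<sigma>\<^sup>2) * measure (obs_law n \<sigma> (\<lambda>_. 0)) B"
proof -
  have "signal r lam U (i, j) = signal r lam U (j, i)" for i j
    by (simp add: signal_def mult.commute)
  then have "(measure (obs_law n \<sigma> (signal r lam U)) B)\<^sup>2
      \<le> exp ((\<Sum>p\<in>upper_triangle n. (signal r lam U p)\<^sup>2) / \<sigma>\<^sup>2) * measure (obs_law n \<sigma> (\<lambda>_. 0)) B"
    using assms(1,3) by (intro measure_obs_law_power2_le)
  also have "\<dots> \<le> exp (lam\<^sup>2 * r / \<sigma>\<^sup>2) * measure (obs_law n \<sigma> (\<lambda>_. 0)) B"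
    using sum_signal_power2_le[OF assms(2), of lam]
    by (intro mult_right_mono) (auto intro: divide_right_mono)
  finally show ?thesis .
qed

lemma measurable_d_2inf_estimator:
  assumes "0 < n" "Uhat \<in> obs_space n \<rightarrow>\<^sub>M est_space n r"
  shows "(\<lambda>Y. d_2inf n r (Uhat Y) U) \<in> borel_measurable (obs_space n)"
  using measurable_compose[OF assms(2) borel_measurable_d_2inf[OF assms(1)]] .

lemma risk_ge_half:
  assumes "0 < \<sigma>" "0 < \<eta>" "0 < n" and Uhat: "Uhat \<in> obs_space n \<rightarrow>\<^sub>M est_space n r"
    and miss: "measure (obs_law n \<sigma> (signal r lam U))
      {Y \<in> space (obs_space n). d_2inf n r (Uhat Y) U < \<eta>} \<le> 1/2"
      (is "measure ?P ?near \<le> _")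
  shows "ennreal (\<eta> / 2) \<le> risk n r \<sigma> lam Uhat U"
proof -
  interpret P: prob_space ?P using \<open>0 < \<sigma>\<close> by (rule prob_space_obs_law)
  have [measurable]: "(\<lambda>Y. d_2inf n r (Uhat Y) U) \<in> borel_measurable (obs_space n)"
    using \<open>0 < n\<close> Uhat by (rule measurable_d_2inf_estimator)
  have near: "?near \<in> sets ?P" by simp
  have "ennreal (\<eta> / 2) \<le> ennreal (\<eta> * measure ?P (space ?P - ?near))"
    using miss near \<open>0 < \<eta>\<close> by (intro ennreal_leI) (simp add: P.prob_compl[OF near] del: space_obs_law)
  also have "\<dots> = (\<integral>\<^sup>+ Y. ennreal \<eta> * indicator (space ?P - ?near) Y \<partial>?P)"
    using near \<open>0 < \<eta>\<close> by (simp add: nn_integral_cmult_indicator P.emeasure_eq_measure ennreal_mult')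
  also have "\<dots> \<le> (\<integral>\<^sup>+ Y. ennreal (d_2inf n r (Uhat Y) U) \<partial>?P)"
    by (intro nn_integral_mono) (auto simp: indicator_def not_less intro: ennreal_leI)
  also have "\<dots> = risk n r \<sigma> lam Uhat U"
    unfolding risk_def obs_law_def by (rule nn_integral_distr[OF measurable_observe]) simp
  finally show ?thesis .
qed

lemma SUP_risk_ge_of_packing:
  assumes "0 < \<sigma>" "0 < \<eta>" "0 < n" and F: "finite F" "F \<subseteq> K_set n r \<mu>"
    and sep: "pairwise (\<lambda>U V. 2 * \<eta> \<le> d_2inf n r U V) F"
    and card: "4 * exp (lam\<^sup>2 * r / \<sigma>\<^sup>2) \<le> card F"
    and Uhat: "Uhat \<in> obs_space n \<rightarrow>\<^sub>M est_space n r"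
  shows "ennreal (\<eta> / 2) \<le> (SUP U \<in> K_set n r \<mu>. risk n r \<sigma> lam Uhat U)"
proof -
  have "0 < 4 * exp (lam\<^sup>2 * r / \<sigma>\<^sup>2)" by simp
  then have "F \<noteq> {}" using card by auto
  define near where "near U = {Y \<in> space (obs_space n). d_2inf n r (Uhat Y) U < \<eta>}" for U
  have [measurable]: "near U \<in> sets (obs_space n)" for U
    using measurable_d_2inf_estimator[OF \<open>0 < n\<close> Uhat] unfolding near_def by measurable
  have "near U \<inter> near V = {}" if "U \<in> F" "V \<in> F" "U \<noteq> V" for U V
  proof -
    have "2 * \<eta> \<le> d_2inf n r U V"
      using sep that by (simp add: pairwise_def)
    then show ?thesis
      using d_2inf_triangle_less[OF \<open>0 < n\<close>, of r _ U \<eta> V \<eta>] by (fastforce simp: near_def)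
  qed
  then have "disjoint_family_on near F"
    by (simp add: disjoint_family_on_def)
  moreover have "orthonormal_cols n r U" if "U \<in> F" for U
    using F(2) that by (auto simp: K_set_def)
  ultimately obtain U where "U \<in> F" "measure (obs_law n \<sigma> (signal r lam U)) (near U) \<le> 1/2"
    using ex_measure_le_half[OF prob_space_obs_law[OF \<open>0 < \<sigma>\<close>, of n "\<lambda>_. 0"] F(1) \<open>F \<noteq> {}\<close>,
        of near "\<lambda>U. obs_law n \<sigma> (signal r lam U)" "exp (lam\<^sup>2 * r / \<sigma>\<^sup>2)"]
      measure_obs_law_signal_power2_le[OF \<open>0 < \<sigma>\<close>] card
    by auto
  then have "ennreal (\<eta> / 2) \<le> risk n r \<sigma> lam Uhat U"
    using risk_ge_half[OF assms(1-3) Uhat] by (simp add: near_def)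
  also have "\<dots> \<le> (SUP U \<in> K_set n r \<mu>. risk n r \<sigma> lam Uhat U)"
    using \<open>U \<in> F\<close> F(2) by (intro SUP_upper) auto
  finally show ?thesis .
qed

section \<open>The minimax lower bound\<close>

lemma four_exp_le_two_powr:
  fixes x y r :: real
  assumes "0 \<le> x" "2048 * (x + 2) \<le> y" "1 \<le> r"
  shows "4 * exp (x * r) \<le> 2 powr (y * r / 1024)"
proof -
  have "ln 4 \<le> (2 :: real)"
    using ln_2_less_1 ln_realpow[of 2 2] by simp
  then have "ln 4 + x * r \<le> (x + 2) * r"
    using \<open>1 \<le> r\<close> by (simp add: distrib_right)
  also have "\<dots> \<le> (y / 2048) * r"
    using assms by (intro mult_right_mono) auto
  also have "\<dots> = 1/2 * (y * r / 1024)"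
    by simp
  also have "\<dots> \<le> ln 2 * (y * r / 1024)"
    using ln2_ge_two_thirds assms by (intro mult_right_mono) auto
  finally have "exp (ln 4 + x * r) \<le> exp (ln 2 * (y * r / 1024))"
    by simp
  then show ?thesis
    by (simp add: exp_add powr_def mult.commute)
qed

lemma SUP_risk_ge_of_blocks:
  assumes "1 \<le> r" "0 < \<sigma>" "Suc b * r \<le> n" "1 / Suc b \<le> r * \<mu> / n"
    and b: "2048 * (lam\<^sup>2 / \<sigma>\<^sup>2 + 2) \<le> b * r"
    and Uhat: "Uhat \<in> obs_space n \<rightarrow>\<^sub>M est_space n r"
  shows "ennreal (1 / (56 * sqrt (Suc b))) \<le> (SUP U \<in> K_set n r \<mu>. risk n r \<sigma> lam Uhat U)"
proof -
  obtain F where F: "finite F" "F \<subseteq> K_set n r \<mu>"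
    "pairwise (\<lambda>U V. 1 / (14 * sqrt (Suc b)) \<le> d_2inf n r U V) F"
    "2 powr (b * (real r)\<^sup>2 / 1024) \<le> card F"
    using K_set_packing[OF assms(1,3,4)] by blast
  have "0 < Suc b * r" using \<open>1 \<le> r\<close> by simp
  then have "0 < n" using assms(3) by linarith
  have "4 * exp (lam\<^sup>2 * r / \<sigma>\<^sup>2) \<le> 2 powr (b * (real r)\<^sup>2 / 1024)"
    using four_exp_le_two_powr[OF _ b, of "real r"] \<open>1 \<le> r\<close> by (simp add: power2_eq_square mult_ac)
  then have "4 * exp (lam\<^sup>2 * r / \<sigma>\<^sup>2) \<le> card F"
    using F(4) by linarith
  then have "ennreal (1 / (28 * sqrt (Suc b)) / 2) \<le> (SUP U \<in> K_set n r \<mu>. risk n r \<sigma> lam Uhat U)"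
    using F(1-3) \<open>0 < n\<close> \<open>0 < \<sigma>\<close> Uhat by (intro SUP_risk_ge_of_packing) auto
  then show ?thesis by simp
qed

lemma ex_block_number:
  fixes x y :: real
  assumes "1 \<le> r" "real r \<le> x" "0 \<le> y"
  shows "\<exists>b::nat. 2048 * (y + 2) \<le> b * r \<and> x \<le> Suc b * r \<and> Suc b * r \<le> 4100 * (x + y)"
proof -
  define t where "t = 2048 * (y + 2 * x)"
  define b where "b = nat \<lceil>t / r\<rceil>"
  have "t / r \<le> b" "b \<le> t / r + 1"
    using assms by (auto simp: b_def t_def)
  then have "t \<le> b * r" "b * r \<le> t + r"
    using \<open>1 \<le> r\<close> by (auto simp: field_simps)
  then show ?thesis
    using assms by (intro exI[of _ b]) (auto simp: t_def algebra_simps)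
qed

lemma min_sqrt_divide_le:
  fixes k m r x y :: real
  assumes "0 < x" "0 < y" "0 < m" "m * r \<le> k * (x + y)"
  shows "min (sqrt (r / y)) (sqrt (r / x)) \<le> sqrt (2 * k) / sqrt m"
proof -
  have "min (r / y) (r / x) * (x + y) = min (r / y) (r / x) * x + min (r / y) (r / x) * y"
    by (rule distrib_left)
  also have "\<dots> \<le> r / x * x + r / y * y"
    using assms(1,2) by (intro add_mono mult_right_mono min.cobounded1 min.cobounded2) auto
  also have "\<dots> = 2 * r"
    using assms(1,2) by simp
  finally have "min (r / y) (r / x) \<le> 2 * r / (x + y)"
    using assms(1,2) by (subst pos_le_divide_eq) auto
  also have "\<dots> \<le> 2 * k / m"
    using assms by (simp add: divide_le_eq le_divide_eq algebra_simps)
  finally have "sqrt (min (r / y) (r / x)) \<le> sqrt (2 * k / m)"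
    by (rule real_sqrt_le_mono)
  moreover have "sqrt (min (r / y) (r / x)) = min (sqrt (r / y)) (sqrt (r / x))"
    by (simp add: min_def)
  ultimately show ?thesis
    by (simp only: real_sqrt_divide)
qed

lemma minimax_risk_ge:
  assumes "1 \<le> r" "0 < \<mu>" "0 < \<sigma>" "0 < lam" "real r \<le> n / \<mu>"
    and size: "4100 * (n / \<mu> + lam\<^sup>2 / \<sigma>\<^sup>2) \<le> n"
  shows "ennreal (1 / 5100 * min (\<sigma> * sqrt r / lam) (sqrt (\<mu> * r / n)))
    \<le> (INF Uhat \<in> obs_space n \<rightarrow>\<^sub>M est_space n r. SUP U \<in> K_set n r \<mu>. risk n r \<sigma> lam Uhat U)"
proof -
  define x y where "x = n / \<mu>" and "y = lam\<^sup>2 / \<sigma>\<^sup>2"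
  have xy: "real r \<le> x" "0 < x" "0 < y"
    using assms by (auto simp: x_def y_def)
  then obtain b where b: "2048 * (y + 2) \<le> b * r" "x \<le> Suc b * r" "Suc b * r \<le> 4100 * (x + y)"
    using ex_block_number[of r x y] \<open>1 \<le> r\<close> by (meson less_imp_le)
  have "Suc b * r \<le> n"
    using b(3) size by (simp add: x_def y_def flip: of_nat_mult)
  have "1 / Suc b \<le> r * \<mu> / n"
    using b(2) xy(2) \<open>0 < \<mu>\<close> by (simp add: x_def field_simps)
  have "min (\<sigma> * sqrt r / lam) (sqrt (\<mu> * r / n)) = min (sqrt (r / y)) (sqrt (r / x))"
    using assms by (simp add: x_def y_def real_sqrt_divide real_sqrt_mult mult.commute)
  also have "\<dots> \<le> sqrt (2 * 4100) / sqrt (Suc b)"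
    using xy b(3) by (intro min_sqrt_divide_le) (auto simp: algebra_simps)
  also have "\<dots> \<le> 91 / sqrt (Suc b)"
    by (intro divide_right_mono real_le_lsqrt) auto
  finally have "1 / 5100 * min (\<sigma> * sqrt r / lam) (sqrt (\<mu> * r / n))
      \<le> 1 / 5100 * (91 / sqrt (Suc b))"
    by simp
  also have "\<dots> \<le> 1 / (56 * sqrt (Suc b))"
    by (simp add: field_simps)
  finally have "ennreal (1 / 5100 * min (\<sigma> * sqrt r / lam) (sqrt (\<mu> * r / n)))
      \<le> ennreal (1 / (56 * sqrt (Suc b)))"
    by (rule ennreal_leI)
  also have "\<dots> \<le> (INF Uhat \<in> obs_space n \<rightarrow>\<^sub>M est_space n r.
      SUP U \<in> K_set n r \<mu>. risk n r \<sigma> lam Uhat U)"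
    using \<open>1 \<le> r\<close> \<open>0 < \<sigma>\<close> \<open>Suc b * r \<le> n\<close> \<open>1 / Suc b \<le> r * \<mu> / n\<close> b(1)
    by (intro INF_greatest SUP_risk_ge_of_blocks) (auto simp: y_def)
  finally show ?thesis .
qed

lemma blocks_fit_in_dimension:
  fixes n \<mu> \<sigma> lam :: real
  assumes "exp 1000 \<le> n" "12 * ln (12 * n) \<le> \<mu>"
    and "0 < \<sigma>" "0 < lam" "lam \<le> \<sigma> * sqrt n / (6 * sqrt 200)"
  shows "4100 * (n / \<mu> + lam\<^sup>2 / \<sigma>\<^sup>2) \<le> n"
proof -
  have "0 < n"
    using assms(1) exp_gt_zero[of 1000] by linarith
  then have "1000 \<le> ln (12 * n)"
    using assms(1) by (subst ln_ge_iff) auto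
  then have "n / \<mu> \<le> n / 12000"
    using assms(2) \<open>0 < n\<close> by (intro divide_left_mono) auto
  moreover have "lam\<^sup>2 / \<sigma>\<^sup>2 \<le> n / 7200"
  proof -
    have "lam\<^sup>2 \<le> (\<sigma> * sqrt n / (6 * sqrt 200))\<^sup>2"
      using assms by (intro power_mono) auto
    also have "\<dots> = \<sigma>\<^sup>2 * (n / 7200)"
      using \<open>0 < n\<close> by (simp add: power_divide power_mult_distrib)
    finally show ?thesis
      using \<open>0 < \<sigma>\<close> by (simp add: field_simps)
  qed
  ultimately show ?thesis
    using \<open>0 < n\<close> by simp
qed

lemma sqrt_divide_ln_le:
  fixes a n \<mu> :: real
  assumes "0 < \<mu>" "4 \<le> n / \<mu>" "0 \<le> a"
  shows "sqrt (a / (n * ln (n / \<mu>))) \<le> sqrt (a / n)"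
proof (rule real_sqrt_le_mono)
  have "0 < n"
    using assms by (simp add: pos_le_divide_eq)
  have "exp 1 \<le> n / \<mu>"
    using assms(2) exp_le by linarith
  then have "1 \<le> ln (n / \<mu>)"
    using assms(2) by (subst ln_ge_iff) auto
  then have "n * 1 \<le> n * ln (n / \<mu>)"
    using \<open>0 < n\<close> by (intro mult_left_mono) auto
  then show "a / (n * ln (n / \<mu>)) \<le> a / n"
    using \<open>0 < n\<close> assms(3) by (intro divide_left_mono) auto
qed

theorem theorem2:
  "\<exists>C0 > 0. \<exists>c > 0. \<exists>N :: nat. \<forall>n \<ge> N. \<forall>(r :: nat) (\<mu> :: real) (\<sigma> :: real) (lam :: real).
     1 \<le> r \<longrightarrow> 0 < \<mu> \<longrightarrow> 0 < \<sigma> \<longrightarrow>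
     real n / \<mu> \<ge> max 4 (real r) \<longrightarrow> \<mu> \<ge> 12 * ln (12 * real n) \<longrightarrow>
     0 < lam \<longrightarrow> lam \<le> \<sigma> * sqrt (real n) / (6 * sqrt C0) \<longrightarrow>
     (INF Uhat \<in> measurable (obs_space n) (est_space n r).
        SUP U \<in> K_set n r \<mu>. risk n r \<sigma> lam Uhat U)
       \<ge> ennreal (c * min (\<sigma> * sqrt (real r) / lam)
                         (sqrt (\<mu> * real r / (real n * ln (real n / \<mu>)))))"
proof (rule exI[of _ "200 :: real"], rule conjI, simp,
    rule exI[of _ "1 / 5100 :: real"], rule conjI, simp,
    rule exI[of _ "nat \<lceil>exp (1000 :: real)\<rceil>"], intro allI impI)
  fix n r :: nat and \<mu> \<sigma> lam :: real
  assume n: "nat \<lceil>exp (1000 :: real)\<rceil> \<le> n" and r: "1 \<le> r" and \<mu>: "0 < \<mu>" and \<sigma>: "0 < \<sigma>"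
    and ratio: "max 4 (real r) \<le> real n / \<mu>" and \<mu>_ge: "12 * ln (12 * real n) \<le> \<mu>"
    and lam: "0 < lam" "lam \<le> \<sigma> * sqrt (real n) / (6 * sqrt 200)"
  let ?rate = "min (\<sigma> * sqrt (real r) / lam) (sqrt (\<mu> * real r / (real n * ln (real n / \<mu>))))"
  have "exp 1000 \<le> real n"
    using n by linarith
  then have size: "4100 * (real n / \<mu> + lam\<^sup>2 / \<sigma>\<^sup>2) \<le> n"
    using \<mu>_ge \<sigma> lam by (rule blocks_fit_in_dimension)
  have "?rate \<le> min (\<sigma> * sqrt r / lam) (sqrt (\<mu> * r / n))"
    using ratio \<mu> by (intro min.mono order_refl sqrt_divide_ln_le) auto
  then have "ennreal (1 / 5100 * ?rate)
      \<le> ennreal (1 / 5100 * min (\<sigma> * sqrt r / lam) (sqrt (\<mu> * r / n)))"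
    by (intro ennreal_leI mult_left_mono) auto
  also have "\<dots> \<le> (INF Uhat \<in> obs_space n \<rightarrow>\<^sub>M est_space n r.
      SUP U \<in> K_set n r \<mu>. risk n r \<sigma> lam Uhat U)"
    using r \<mu> \<sigma> lam(1) ratio size by (intro minimax_risk_ge) auto
  finally show "ennreal (1 / 5100 * ?rate) \<le> (INF Uhat \<in> obs_space n \<rightarrow>\<^sub>M est_space n r.
      SUP U \<in> K_set n r \<mu>. risk n r \<sigma> lam Uhat U)" .
qed

end
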